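(* Let $q$ be a prime power, let $\mathsf{H}(3,q^2)$ be the Hermitian surface of $\mathrm{PG}(3,q^2)$ defined by the Hermitian form $\langle X,Y\rangle=X_0Y_0^q+X_1Y_1^q+X_2Y_2^q+X_3Y_3^q$, let $\mathcal{O}$ be the Hermitian curve $\mathsf{H}(3,q^2)\cap\{X_3=0\}$, and call the points of $\mathsf{H}(3,q^2)\setminus\mathcal{O}$ affine points. Let $\mathsf{SU}_3$ denote the group of collineations of $\mathsf{H}(3,q^2)$ given (projectively) by the matrices $M_A=\begin{pmatrix}A&0\\0&1\end{pmatrix}$ with $A\in\mathsf{SU}_3(q)$. Suppose $\Omega$ is a set of Baer subgenerators of $\mathsf{H}(3,q^2)$, each with a point in $\mathcal{O}$, such that every affine point is on exactly $q+1$ elements of $\Omega$ spanning a Baer subplane. Then $\Omega$ is an orbit of $\mathsf{SU}_3$.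
   Context: A generator of $\mathsf{H}(3,q^2)$ is a totally isotropic line; a Baer subline is a set of $q+1$ collinear points forming a subgeometry $\mathrm{PG}(1,q)$; a Baer subgenerator is a Baer subline contained in a generator; a Baer subplane is a set of points of a plane forming a subgeometry $\mathrm{PG}(2,q)$. $\mathsf{SU}_3(q)$ is the group of $3\times3$ determinant-one matrices over $\mathrm{GF}(q^2)$ preserving the form $X_0Y_0^q+X_1Y_1^q+X_2Y_2^q$. *)

theory Defs
  imports
    "HOL-Analysis.Analysis"
    "HOL-Algebra.Group_Action"
    "HOL-Number_Theory.Prime_Powers"
begin

(* The field GF(q^2) is a finite field 'a with CARD('a) = q^2. The elements of the index
   type 4 are 0, 1, 2, 3 and those of the index type 3 are 0, 1, 2, so indices of vectors
   and matrices are literally those of the homogeneous coordinates X_0, ..., X_3.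
   Subspaces of projective space are identified with linear subspaces; in particular, a point
   is a one-dimensional subspace, and a point P lies on a line L iff P is a subset of L. *)

definition pg_point :: "('a::field ^ 'n) set \<Rightarrow> bool" where
  "pg_point P \<longleftrightarrow> vec.subspace P \<and> vec.dim P = 1"

definition pg_line :: "('a::field ^ 'n) set \<Rightarrow> bool" where
  "pg_line L \<longleftrightarrow> vec.subspace L \<and> vec.dim L = 2"

definition hform :: "nat \<Rightarrow> 'a::field ^ 'n \<Rightarrow> 'a ^ 'n \<Rightarrow> 'a" where
  "hform q X Y = (\<Sum>i\<in>UNIV. X $ i * (Y $ i) ^ q)"

definition hermitian_surface :: "nat \<Rightarrow> ('a::field ^ 4) set set" where
  "hermitian_surface q = {P. pg_point P \<and> (\<forall>X\<in>P. hform q X X = 0)}"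

definition hermitian_curve :: "nat \<Rightarrow> ('a::field ^ 4) set set" where
  "hermitian_curve q = {P \<in> hermitian_surface q. \<forall>X\<in>P. X $ 3 = 0}"

definition affine_points :: "nat \<Rightarrow> ('a::field ^ 4) set set" where
  "affine_points q = hermitian_surface q - hermitian_curve q"

definition generator :: "nat \<Rightarrow> ('a::field ^ 4) set \<Rightarrow> bool" where
  "generator q L \<longleftrightarrow> pg_line L \<and> (\<forall>X\<in>L. \<forall>Y\<in>L. hform q X Y = 0)"

(* The subfield GF(q) of GF(q^2), as the fixed field of the Frobenius map. *)
definition GF_sub :: "nat \<Rightarrow> 'a::field set" where
  "GF_sub q = {a. a ^ q = a}"

(* The point set of a subgeometry PG(d,q): the points spanned by the nonzero
   GF(q)-linear combinations of d + 1 vectors that are independent over the whole field. *)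
definition baer_subgeometry :: "nat \<Rightarrow> nat \<Rightarrow> ('a::field ^ 'n) set set \<Rightarrow> bool" where
  "baer_subgeometry q d S \<longleftrightarrow>
     (\<exists>B. vec.independent B \<and> card B = d + 1 \<and>
       S = {vec.span {\<Sum>v\<in>B. c v *s v} | c.
              (\<forall>v\<in>B. c v \<in> GF_sub q) \<and> (\<exists>v\<in>B. c v \<noteq> 0)})"

definition baer_subline :: "nat \<Rightarrow> ('a::field ^ 'n) set set \<Rightarrow> bool" where
  "baer_subline q b \<longleftrightarrow> baer_subgeometry q 1 b"

definition baer_subplane :: "nat \<Rightarrow> ('a::field ^ 'n) set set \<Rightarrow> bool" where
  "baer_subplane q \<pi> \<longleftrightarrow> baer_subgeometry q 2 \<pi>"

definition baer_subgenerator :: "nat \<Rightarrow> ('a::field ^ 4) set set \<Rightarrow> bool" where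
  "baer_subgenerator q b \<longleftrightarrow>
     baer_subline q b \<and> (\<exists>L. generator q L \<and> (\<forall>P\<in>b. P \<subseteq> L))"

(* A family of Baer sublines spans the least Baer subplane containing all of them. *)
definition spans_baer_subplane :: "nat \<Rightarrow> ('a::field ^ 'n) set set set \<Rightarrow> bool" where
  "spans_baer_subplane q F \<longleftrightarrow>
     (\<exists>\<pi>. baer_subplane q \<pi> \<and> \<Union>F \<subseteq> \<pi> \<and>
       (\<forall>\<pi>'. baer_subplane q \<pi>' \<and> \<Union>F \<subseteq> \<pi>' \<longrightarrow> \<pi> \<subseteq> \<pi>'))"

definition SU3_matrices :: "nat \<Rightarrow> ('a::field ^ 3 ^ 3) set" where
  "SU3_matrices q = {A. det A = 1 \<and> (\<forall>X Y. hform q (A *v X) (A *v Y) = hform q X Y)}"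

(* Sends the index i of type 4 to the index i of type 3, for i = 0, 1, 2; the value at 3 is irrelevant. *)
definition index_3 :: "4 \<Rightarrow> 3" where
  "index_3 i = (if i = 1 then 1 else if i = 2 then 2 else 0)"

definition block_matrix :: "'a::field ^ 3 ^ 3 \<Rightarrow> 'a ^ 4 ^ 4" where
  "block_matrix A =
     (\<chi> i j. if i = 3 \<and> j = 3 then 1
            else if i = 3 \<or> j = 3 then 0
            else A $ index_3 i $ index_3 j)"

definition collineation :: "'a::field ^ 'n ^ 'n \<Rightarrow> ('a ^ 'n) set \<Rightarrow> ('a ^ 'n) set" where
  "collineation M P = (\<lambda>X. M *v X) ` P"

definition SU3_group :: "nat \<Rightarrow> (('a::field ^ 4) set \<Rightarrow> ('a ^ 4) set) monoid" where
  "SU3_group q =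
     \<lparr>carrier = (\<lambda>A. collineation (block_matrix A)) ` SU3_matrices q,
      mult = (\<circ>), one = id\<rparr>"

end

theory Submission
  imports Defs "HOL-Number_Theory.Residues"
begin

text \<open>An affine point is a vector $x$ of the Hermitian space $V = \mathrm{GF}(q^2)^3$ with
  $\langle x, x\rangle = -1$, and the Baer subgenerators through it that meet
  $\mathcal{O}$ are the sets $\{x + tz : t \in \mathrm{GF}(q)\} \cup \{z\}$ with $z$ isotropic and
  orthogonal to $x$. For such $z$ one has $x \times z = -c\bar z$ with a scalar $c$ of norm 1
  that depends only on $z$ modulo $\mathrm{GF}(q)^*$. The Baer subplane condition forces all $q+1$
  directions $z$ at $x$ to have the same $c$, so $\Omega$ amounts to a function $x \mapsto c(x)$.
  On the affine plane over $\mathrm{GF}(q)$ that the affine points of a generator form,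
  this function picks a parallel class at every point, constant along the lines picked; since
  nonparallel lines meet, $c$ is constant on generators. Any two affine points are linked by a
  chain of generators, so $c$ is constant. Finally the equation $x \times z = -c\bar z$ is
  invariant under $\mathsf{SU}_3(q)$, and the pairs $(x, z)$ satisfying it form a single orbit:
  the determinant of the isometry carrying one pair to another is 1 because
  $\det(x, z, f) = -c\langle f, z\rangle$.\<close>

section \<open>The field of order $q^2$\<close>

text \<open>\<open>q\<close> alone mentions no type variable, so \<open>T\<close> names the field
  for interpretations.\<close>

locale gfq2 =
  fixes q :: nat and T :: "'a::{field,finite} itself"
  assumes q_primepow: "primepow q" and card_field: "CARD('a) = q ^ 2"
begin

lemma q_gt_1: "q > 1"
  using q_primepow primepow_gt_Suc_0 by auto

text \<open>Multiplication by a nonzero \<open>a\<close> permutes the nonzero elements, so their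
  product absorbs the factor \<open>a ^ (q ^ 2 - 1)\<close>.\<close>

lemma power_card: "(a::'a) ^ (q ^ 2) = a"
proof (cases "a = 0")
  case True then show ?thesis using q_gt_1 by simp
next
  case False
  have inj: "inj_on ((*) a) (UNIV - {0})" using False by (auto intro: inj_onI)
  have img: "(*) a ` (UNIV - {0}) = UNIV - {0}"
    using False inj by (intro endo_inj_surj) auto
  have "(\<Prod>x\<in>UNIV - {0}. x) = (\<Prod>x\<in>(*) a ` (UNIV - {0}). x)" by (simp only: img)
  also have "\<dots> = (\<Prod>x\<in>UNIV - {0}. a * x)" by (subst prod.reindex[OF inj]) simp
  also have "\<dots> = a ^ (q ^ 2 - 1) * (\<Prod>x\<in>UNIV - {0}. x)"
    by (simp add: prod.distrib card_Diff_singleton card_field)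
  finally have "a ^ (q ^ 2 - 1) = 1" by simp
  then have "a ^ Suc (q ^ 2 - 1) = a" by simp
  then show ?thesis using q_gt_1 by simp
qed

text \<open>The characteristic is a prime dividing \<open>q ^ 2\<close>, hence the prime of which
  \<open>q\<close> is a power, and the freshman's dream applies.\<close>

lemma frobenius_add: "((a::'a) + b) ^ q = a ^ q + b ^ q"
proof -
  obtain p n where p: "prime p" "q = p ^ n" "n > 0"
    using q_primepow unfolding primepow_def by auto
  have pr: "prime (CHAR('a))"
    by (rule prime_CHAR_semidom) (simp add: finite_imp_CHAR_pos)
  moreover have "CHAR('a) dvd q ^ 2" using CHAR_dvd_CARD[where 'a='a] card_field by simp
  ultimately have "CHAR('a) = p"
    using p primes_dvd_imp_eq prime_dvd_power by metis
  then show ?thesis using freshmans_dream'[OF pr] p by blast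
qed

text \<open>The involution of GF(q^2) over GF(q). Naming it lets simplification use automorphism
  laws in place of powers.\<close>

definition cj :: "'a \<Rightarrow> 'a" where "cj a = a ^ q"

definition K :: "'a set" where "K = {a. cj a = a}"

lemma K_GF_sub: "K = GF_sub q" by (simp add: K_def GF_sub_def cj_def)

lemma cj_add [simp]: "cj (a + b) = cj a + cj b" by (simp add: cj_def frobenius_add)
lemma cj_mult [simp]: "cj (a * b) = cj a * cj b" by (simp add: cj_def power_mult_distrib)
lemma cj_0 [simp]: "cj 0 = 0" using q_gt_1 by (simp add: cj_def)
lemma cj_1 [simp]: "cj 1 = 1" by (simp add: cj_def)
lemma cj_cj [simp]: "cj (cj a) = a"
  using power_card[of a] by (simp add: cj_def power_mult[symmetric] power2_eq_square)
lemma cj_2 [simp]: "cj 2 = 2" using cj_add[of 1 1] by simp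
lemma cj_minus [simp]: "cj (- a) = - cj a"
  using cj_add[of a "- a"] by (simp add: eq_neg_iff_add_eq_0 add.commute)
lemma cj_diff [simp]: "cj (a - b) = cj a - cj b"
  using cj_add[of a "- b"] by simp
lemma cj_divide [simp]: "cj (a / b) = cj a / cj b"
  by (simp add: cj_def power_divide)
lemma cj_eq_0_iff [simp]: "cj a = 0 \<longleftrightarrow> a = 0"
  using q_gt_1 by (simp add: cj_def)

lemma K_closed:
  "0 \<in> K" "1 \<in> K" "a \<in> K \<Longrightarrow> b \<in> K \<Longrightarrow> a + b \<in> K" "a \<in> K \<Longrightarrow> b \<in> K \<Longrightarrow> a * b \<in> K"
  "a \<in> K \<Longrightarrow> b \<in> K \<Longrightarrow> a - b \<in> K" "a \<in> K \<Longrightarrow> - a \<in> K" "a \<in> K \<Longrightarrow> b \<in> K \<Longrightarrow> a / b \<in> K"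
  by (auto simp: K_def)

section \<open>Surjectivity of the trace and the norm by counting roots\<close>

lemma card_roots_le:
  fixes P :: "'a poly"
  assumes "P \<noteq> 0" "degree P \<le> n" "\<And>a. a \<in> S \<Longrightarrow> poly P a = 0"
  shows "card S \<le> n"
proof -
  have "card S \<le> card {a. poly P a = 0}"
    using assms(3) by (intro card_mono) auto
  also have "\<dots> \<le> degree P" using assms(1) by (rule card_poly_roots_bound)
  finally show ?thesis using assms(2) by simp
qed

text \<open>The elements of \<open>K\<close> are roots of X^q - X; the two bounds that follow use
  X^q + X - b and X^(q+1) - b in the same way.\<close>

lemma card_K_le: "card K \<le> q"
proof (rule card_roots_le[of "Polynomial.monom 1 q - Polynomial.monom 1 1"])
  show "Polynomial.monom 1 q - Polynomial.monom 1 1 \<noteq> (0::'a poly)"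
    using q_gt_1 by (simp add: monom_eq_iff')
  show "degree (Polynomial.monom 1 q - Polynomial.monom 1 1 :: 'a poly) \<le> q"
    using q_gt_1 by (intro degree_diff_le) (auto simp: degree_monom_eq)
qed (auto simp: K_def cj_def poly_monom)

lemma card_trace_fibre_le: "card {a. a + cj a = b} \<le> q"
proof (rule card_roots_le[of "Polynomial.monom 1 q + [:- b, 1:]"])
  have "degree (Polynomial.monom 1 q + [:- b, 1:]) = q"
    using q_gt_1 by (subst degree_add_eq_left) (auto simp: degree_monom_eq)
  then show "degree (Polynomial.monom 1 q + [:- b, 1:]) \<le> q" "Polynomial.monom 1 q + [:- b, 1:] \<noteq> 0"
    using q_gt_1 by auto
qed (auto simp: cj_def poly_monom)

lemma card_norm_fibre_le: "card {a. a * cj a = b} \<le> q + 1"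
proof (rule card_roots_le[of "Polynomial.monom 1 (q + 1) + [:- b:]"])
  have "degree (Polynomial.monom 1 (q + 1) + [:- b:]) = q + 1"
    by (subst degree_add_eq_left) (auto simp: degree_monom_eq)
  then show "degree (Polynomial.monom 1 (q + 1) + [:- b:]) \<le> q + 1" "Polynomial.monom 1 (q + 1) + [:- b:] \<noteq> 0"
    by auto
qed (auto simp: cj_def poly_monom)

text \<open>Fibres of size at most \<open>m\<close> give the image at least
  \<open>card A / m\<close> elements, which is no less than \<open>card B\<close>. This turns root
  bounds into surjectivity.\<close>

lemma fibre_surj:
  fixes f :: "'a \<Rightarrow> 'a"
  assumes "f ` A \<subseteq> B" "\<And>b. card {a. f a = b} \<le> m" "m > 0"
    and "card B \<le> n" "n * m \<le> card A" "b \<in> B"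
  shows "b \<in> f ` A"
proof -
  have "card A = card (\<Union>b\<in>f ` A. {a \<in> A. f a = b})" by (rule arg_cong[where f=card]) auto
  also have "\<dots> \<le> (\<Sum>b\<in>f ` A. card {a \<in> A. f a = b})" by (rule card_UN_le) simp
  also have "\<dots> \<le> (\<Sum>b\<in>f ` A. m)"
  proof (rule sum_mono)
    fix b
    have "card {a \<in> A. f a = b} \<le> card {a. f a = b}" by (intro card_mono) auto
    then show "card {a \<in> A. f a = b} \<le> m" using assms(2) le_trans by blast
  qed
  finally have "card A \<le> card (f ` A) * m" by simp
  with assms(5) have "n * m \<le> card (f ` A) * m" by linarith
  then have "card B \<le> card (f ` A)" using assms(3,4) by simp
  then have "f ` A = B" using assms(1) by (intro card_seteq) auto
  then show ?thesis using assms(6) by simp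
qed

lemma trace_surj:
  assumes "b \<in> K" obtains a where "a + cj a = b"
proof -
  have "b \<in> (\<lambda>a. a + cj a) ` UNIV"
    using card_K_le card_trace_fibre_le assms q_gt_1
    by (intro fibre_surj[where m=q and n=q and B=K]) (auto simp: K_def card_field power2_eq_square add.commute)
  then show thesis using that by auto
qed

text \<open>For nonzero \<open>b\<close> the count runs over the q^2 - 1 = (q - 1)(q + 1) nonzero
  elements.\<close>

lemma norm_surj:
  assumes "b \<in> K" obtains a where "a * cj a = b"
proof (cases "b = 0")
  case True then show ?thesis using that[of 0] by simp
next
  case False
  have c: "card (K - {0}) \<le> q - 1"
    using card_K_le K_closed(1) by (simp add: card_Diff_singleton)
  have e: "(q - 1) * (q + 1) = q ^ 2 - 1"
    by (simp add: algebra_simps power2_eq_square)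
  have "b \<in> (\<lambda>a. a * cj a) ` (UNIV - {0})"
    using c card_norm_fibre_le assms q_gt_1 False e mult_right_mono[OF c, of "q+1"]
    by (intro fibre_surj[where m="q + 1" and n="q - 1" and B="K - {0}"])
       (auto simp: K_def card_field card_Diff_singleton mult.commute)
  then show thesis using that by auto
qed

lemma ex_not_K: obtains a where "a \<notin> K"
proof -
  have "card K < CARD('a)"
    using card_K_le q_gt_1 card_field by (simp add: power2_eq_square order.strict_trans1)
  then have "K \<noteq> UNIV" by auto
  then show thesis using that by auto
qed

text \<open>For every \<open>t\<close> the element \<open>t + cj e * cj t\<close> solves the
  equation. It is nonzero for \<open>t = 1\<close> unless \<open>cj e = - 1\<close>; then it equals
  \<open>t - cj t\<close>, and any \<open>t\<close> outside \<open>K\<close> serves.\<close>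

lemma hilbert90:
  assumes "e * cj e = 1"
  obtains l where "l \<noteq> 0" "cj l = e * l"
proof -
  have *: "cj (t + cj e * cj t) = e * (t + cj e * cj t)" for t
    using assms by (simp add: algebra_simps)
  obtain t where t: "t \<notin> K" by (rule ex_not_K)
  show thesis
  proof (cases "1 + cj e = 0")
    case True
    then have "cj e = - 1" by (simp add: eq_neg_iff_add_eq_0 add.commute)
    then show ?thesis using that[of "t + cj e * cj t"] *[of t] t by (auto simp: K_def)
  next
    case False
    then show ?thesis using that[of "1 + cj e"] *[of 1] by simp
  qed
qed

end

section \<open>The Hermitian space of dimension 3\<close>

definition cross :: "'a::field ^ 3 \<Rightarrow> 'a ^ 3 \<Rightarrow> 'a ^ 3" where
  "cross x y = vector [x $ 2 * y $ 3 - x $ 3 * y $ 2, x $ 3 * y $ 1 - x $ 1 * y $ 3,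
     x $ 1 * y $ 2 - x $ 2 * y $ 1]"

lemma cross_nth [simp]:
  "cross x y $ 1 = x $ 2 * y $ 3 - x $ 3 * y $ 2"
  "cross x y $ 2 = x $ 3 * y $ 1 - x $ 1 * y $ 3"
  "cross x y $ 3 = x $ 1 * y $ 2 - x $ 2 * y $ 1"
  by (simp_all add: cross_def)

lemmas vec3_simps = vec_eq_iff forall_3

lemma cross_linear:
  "cross (x + y) z = cross x z + cross y z" "cross (- x) y = - cross x y"
  "cross x (y + z) = cross x y + cross x z"
  "cross (k *s x) y = k *s cross x y" "cross x (k *s y) = k *s cross x y"
  "cross x (y - z) = cross x y - cross x z" "cross x x = 0" "cross x 0 = 0"
  by (simp_all add: vec3_simps algebra_simps)

lemma cross_eq_0_imp_parallel:
  assumes "cross u w = 0" "u \<noteq> 0"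
  obtains k where "w = k *s u"
proof -
  have e: "u $ 2 * w $ 3 = u $ 3 * w $ 2" "u $ 3 * w $ 1 = u $ 1 * w $ 3" "u $ 1 * w $ 2 = u $ 2 * w $ 1"
    using assms(1) by (simp_all add: vec3_simps)
  consider "u $ 1 \<noteq> 0" | "u $ 2 \<noteq> 0" | "u $ 3 \<noteq> 0"
    using assms(2) by (auto simp: vec3_simps)
  then show thesis
  proof cases
    case 1
    then show thesis using e by (intro that[of "w $ 1 / u $ 1"]) (simp add: vec3_simps field_simps)
  next
    case 2
    then show thesis using e by (intro that[of "w $ 2 / u $ 2"]) (simp add: vec3_simps field_simps)
  next
    case 3
    then show thesis using e by (intro that[of "w $ 3 / u $ 3"]) (simp add: vec3_simps field_simps)
  qed
qed

context gfq2
begin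

section \<open>Conjugate vectors and the Hermitian form\<close>

definition cv :: "'a ^ 3 \<Rightarrow> 'a ^ 3" where "cv x = (\<chi> i. cj (x $ i))"

lemma cv_nth [simp]: "cv x $ i = cj (x $ i)" by (simp add: cv_def)

lemma cv_simps [simp]:
  "cv (x + y) = cv x + cv y" "cv (x - y) = cv x - cv y" "cv (k *s x) = cj k *s cv x" "cv (cv x) = x"
  "cv (- x) = - cv x" "cv (cross x y) = cross (cv x) (cv y)" "cv x = 0 \<longleftrightarrow> x = 0"
  by (simp_all add: vec3_simps)

abbreviation h :: "'a ^ 3 \<Rightarrow> 'a ^ 3 \<Rightarrow> 'a" where "h \<equiv> hform q"

lemma h_expand: "h x y = x $ 1 * cj (y $ 1) + x $ 2 * cj (y $ 2) + x $ 3 * cj (y $ 3)"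
  by (simp add: hform_def sum_3 cj_def)

lemma h_simps [simp]:
  "h (x + y) z = h x z + h y z" "h x (y + z) = h x y + h x z"
  "h (x - y) z = h x z - h y z" "h x (y - z) = h x y - h x z"
  "h (k *s x) y = k * h x y" "h x (k *s y) = cj k * h x y"
  "h (- x) y = - h x y" "h x (- y) = - h x y" "h 0 y = 0" "h x 0 = 0"
  by (simp_all add: h_expand algebra_simps)

lemma h_cj: "cj (h x y) = h y x"
  by (simp add: h_expand algebra_simps)

lemma h_self_K: "h x x \<in> K"
  by (simp add: K_def h_cj)

lemma h_cv [simp]: "h (cv x) (cv y) = h y x"
  by (simp add: h_expand algebra_simps)

lemma h_eq_0_sym: "h x y = 0 \<longleftrightarrow> h y x = 0"
  by (metis h_cj cj_eq_0_iff)

lemma h_nondegenerate: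
  assumes "\<And>y. h x y = 0" shows "x = 0"
  using assms[of "axis 1 1"] assms[of "axis 2 1"] assms[of "axis 3 1"]
  by (simp add: h_expand axis_def vec3_simps)

text \<open>Grassmann's identity for the triple vector product; the conjugations turn its dot
  products into values of \<open>h\<close>.\<close>

lemma cross_cross_cv:
  "cross (cv x) (cross y z) = h z x *s y - h y x *s z"
  "cross (cross x y) (cv z) = h x z *s y - h y z *s x"
  "cross x (cross (cv y) (cv z)) = h x z *s cv y - h x y *s cv z"
  "cross (cross (cv x) (cv y)) z = h z x *s cv y - h z y *s cv x"
  by (simp_all add: vec3_simps h_expand algebra_simps)

text \<open>\<open>h u (cv v)\<close> is the bilinear dot product of \<open>u\<close> and
  \<open>v\<close>, for which a vector product is orthogonal to its factors.\<close>

lemma h_cross_self [simp]: "h (cross x y) (cv x) = 0" "h (cross x y) (cv y) = 0"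
  by (simp_all add: h_expand algebra_simps)

text \<open>For $c$ of norm 1 and $z \neq 0$ this says that $z$ is isotropic and orthogonal to $x$,
  and it singles out one of the $q+1$ classes, modulo $\mathrm{GF}(q)^*$, of nonzero vectors
  that span the same point as $z$.\<close>

definition rel :: "'a \<Rightarrow> 'a ^ 3 \<Rightarrow> 'a ^ 3 \<Rightarrow> bool" where
  "rel c x z \<longleftrightarrow> cross x z = - (c *s cv z)"

text \<open>Grassmann's identity shows first that \<open>cross x z\<close> is a multiple
  \<open>k\<close> of \<open>cv z\<close>, then that conjugating and multiplying by \<open>x\<close>
  once more returns \<open>cv z\<close>, so \<open>k\<close> has norm 1.\<close>

lemma rel_exists:
  assumes "h x x = - 1" "z \<noteq> 0" "h z z = 0" "h x z = 0"
  obtains c where "c * cj c = 1" "rel c x z"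
proof -
  have "cross (cv z) (cross x z) = 0"
    using assms by (simp add: cross_cross_cv)
  then obtain k where k: "cross x z = k *s cv z"
    using assms(2) by (metis cross_eq_0_imp_parallel cv_simps(7))
  have "cross (cv x) (cv z) = cj k *s z"
    using arg_cong[OF k, of cv] by simp
  then have "cross x (cross (cv x) (cv z)) = (cj k * k) *s cv z"
    by (simp add: cross_linear k vector_smult_assoc)
  moreover have "cross x (cross (cv x) (cv z)) = cv z"
    using assms(1,4) by (simp add: cross_cross_cv)
  ultimately have "(cj k * k) *s cv z = 1 *s cv z" by simp
  then have "cj k * k = 1"
    using assms(2) by (metis vec.scale_right_imp_eq cv_simps(7))
  then show thesis using k by (intro that[of "- k"]) (simp_all add: rel_def mult.commute)
qed

lemma rel_orthogonal:
  assumes "rel c x z" "c \<noteq> 0"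
  shows "h x z = 0" "h z z = 0"
proof -
  have "c * h x z = 0" "c * h z z = 0"
    using h_cross_self[of x z, unfolded assms(1)[unfolded rel_def]] by simp_all
  then show "h x z = 0" "h z z = 0" using assms(2) by simp_all
qed

lemma rel_unique: "rel c x z \<Longrightarrow> rel d x z \<Longrightarrow> z \<noteq> 0 \<Longrightarrow> c = d"
  unfolding rel_def by (metis neg_equal_iff_equal vec.scale_right_imp_eq cv_simps(7))

lemma rel_scale: "rel c x z \<Longrightarrow> k \<in> K \<Longrightarrow> rel c x (k *s z)"
  by (simp add: rel_def cross_linear K_def vector_smult_assoc mult.commute)

text \<open>As \<open>cross z z = 0\<close>, all affine points of a Baer subline with direction
  \<open>z\<close> see the same constant.\<close>

lemma rel_translate: "rel c (x + k *s z) z \<longleftrightarrow> rel c x z"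
  by (simp add: rel_def cross_linear)

text \<open>The vectors orthogonal to \<open>x\<close> and \<open>z\<close> are the multiples of the
  product of their conjugates, which by \<open>rel\<close> is itself a multiple of
  \<open>z\<close>.\<close>

lemma rel_perp_parallel:
  assumes "rel c x z" "c \<noteq> 0" "z \<noteq> 0" "h w x = 0" "h w z = 0"
  obtains k where "w = k *s z"
proof -
  have "cross (cv x) (cv z) = - (cj c *s z)"
    using arg_cong[OF assms(1)[unfolded rel_def], of cv] by simp
  moreover have "cross (cross (cv x) (cv z)) w = 0"
    using assms(4,5) by (simp add: cross_cross_cv)
  ultimately have "cross (- (cj c *s z)) w = 0" by simp
  then have "cross z w = 0" using assms(2) by (simp add: cross_linear)
  then show thesis using assms(3) cross_eq_0_imp_parallel that by blast
qed

text \<open>Two isotropic vectors with nonzero product form a basis of the plane orthogonal to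
  \<open>x\<close>; each coordinate is read off by pairing with the other vector.\<close>

lemma rel_plane_coordinates:
  assumes "rel c x z" "c \<noteq> 0" "z \<noteq> 0" "rel d x w" "d \<noteq> 0" "h w z \<noteq> 0" "h v x = 0"
  obtains a b where "v = a *s z + b *s w"
proof -
  have nz: "h z w \<noteq> 0" using assms(6) h_eq_0_sym by blast
  define a where "a = h v w / h z w"
  define b where "b = h v z / h w z"
  define u where "u = v - a *s z - b *s w"
  note o = rel_orthogonal[OF assms(1,2)] rel_orthogonal[OF assms(4,5)]
  have "h u x = 0" using o assms(7) h_eq_0_sym[of z x] h_eq_0_sym[of w x] by (simp add: u_def)
  moreover have "h u z = 0" using o assms(6) by (simp add: u_def b_def)
  ultimately obtain k where k: "u = k *s z" using assms(1-3) rel_perp_parallel by blast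
  have "h u w = 0" using o nz by (simp add: u_def a_def)
  then have "u = 0" using k nz by simp
  then show thesis by (intro that[of a b]) (simp add: u_def algebra_simps)
qed

text \<open>With \<open>hilbert90\<close>, every isotropic direction at \<open>x\<close> has
  representatives for each constant of norm 1.\<close>

lemma rel_rescale:
  assumes "rel d x u" "c \<noteq> 0" "cj l = d / c * l"
  shows "rel c x (l *s u)"
  using assms by (simp add: rel_def cross_linear vector_smult_assoc mult.commute)

text \<open>Each affine point of a generator is assigned one parallel class of lines of
  the affine plane $\mathrm{AG}(2,q)$ that the affine part of the generator forms over
  $\mathrm{GF}(q)$, and this class is constant along the line in this class through the point.
  As lines of different parallel classes meet, the class is the same for all points.\<close>

lemma constant_on_generators:
  assumes norm: "\<And>x. h x x = - 1 \<Longrightarrow> C x * cj (C x) = 1"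
    and step: "\<And>x z k. h x x = - 1 \<Longrightarrow> z \<noteq> 0 \<Longrightarrow> rel (C x) x z \<Longrightarrow> k \<in> K \<Longrightarrow> C (x + k *s z) = C x"
    and x: "h x x = - 1" and u: "h x u = 0" "h u u = 0"
  shows "C (x + u) = C x"
proof (cases "u = 0")
  case False
  have u': "h u x = 0" using u(1) h_eq_0_sym by blast
  have xu: "h (x + u) (x + u) = - 1" using x u u' by simp
  note n = norm[OF x] norm[OF xu]
  have nz: "C x \<noteq> 0" "C (x + u) \<noteq> 0" using n by auto
  obtain d where d: "d * cj d = 1" "rel d x u" using rel_exists[OF x False u(2,1)] .
  then have d0: "d \<noteq> 0" by auto
  have d': "rel d (x + u) u" using d(2) rel_translate[of d x 1 u] by simp
  obtain l where l: "l \<noteq> 0" "cj l = d / C x * l"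
    by (rule hilbert90[of "d / C x"]) (use d(1) n(1) nz in \<open>simp add: divide_simps\<close>)
  obtain m where m: "m \<noteq> 0" "cj m = d / C (x + u) * m"
    by (rule hilbert90[of "d / C (x + u)"]) (use d(1) n(2) nz in \<open>simp add: divide_simps\<close>)
  note rl = rel_rescale[OF d(2) nz(1) l(2)] and rm = rel_rescale[OF d' nz(2) m(2)]
  show ?thesis
  proof (rule ccontr)
    assume ne: "C (x + u) \<noteq> C x"
    \<comment> \<open>\<open>D\<close> vanishes exactly when the directions \<open>l *s u\<close>
      and \<open>m *s u\<close> are parallel over GF(q). Cramer's rule for
      \<open>r * l + s * m = 1\<close> and its conjugate gives \<open>r\<close> and
      \<open>s\<close>, hence the point where the two lines meet.\<close>
    define D where "D = l * cj m - cj l * m"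
    have "D = l * m * d * (C x - C (x + u)) / (C x * C (x + u))"
      using nz by (simp add: D_def l m field_simps)
    then have D: "D \<noteq> 0" using l(1) m(1) d0 nz ne by simp
    define r where "r = (cj m - m) / D"
    define s where "s = (l - cj l) / D"
    have cD: "cj D = - D" by (simp add: D_def)
    have K: "r \<in> K" "- s \<in> K" using D by (simp_all add: K_def r_def s_def cD field_simps)
    have "(r * l + s * m) * D = r * D * l + s * D * m" by (simp add: algebra_simps)
    also have "\<dots> = D" using D by (simp add: r_def s_def) (simp add: D_def algebra_simps)
    finally have "r * l + s * m = 1" using D by simp
    then have "u = (r * l + s * m) *s u" by simp
    then have "x + r *s (l *s u) = (x + u) + (- s) *s (m *s u)"
      by (simp add: vec3_simps algebra_simps)
    moreover have "C (x + r *s (l *s u)) = C x"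
      using step[OF x _ rl K(1)] l(1) False by simp
    moreover have "C ((x + u) + (- s) *s (m *s u)) = C (x + u)"
      using step[OF xu _ rm K(2)] m(1) False by simp
    ultimately show False using ne by metis
  qed
qed simp

text \<open>Product -1 means that two affine points lie on a common generator. The vectors
  \<open>x\<close> and \<open>y\<close> span a nondegenerate plane, the required products fix the
  component of \<open>v\<close> in it, and the component along the normal \<open>n\<close> adjusts
  \<open>h v v\<close>.\<close>

lemma ex_common_neighbour:
  assumes x: "h x x = - 1" and y: "h y y = - 1" and N: "h x y * cj (h x y) \<noteq> 1"
  obtains v where "h v v = - 1" "h v x = - 1" "h v y = - 1"
proof -
  define s where "s = h x y"
  have hyx: "h y x = cj s" by (simp add: s_def h_cj)
  define D where "D = 1 - s * cj s"
  have D: "D \<noteq> 0" using N by (simp add: D_def s_def)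
  have cD: "cj D = D" by (simp add: D_def mult.commute)
  \<comment> \<open>\<open>a\<close> and \<open>b\<close> solve the Gram system given by
    \<open>h v x = - 1\<close> and \<open>h v y = - 1\<close>.\<close>
  define a where "a = (1 + cj s) / D"
  define b where "b = (1 + s) / D"
  define n where "n = cv (cross x y)"
  have nx: "h n x = 0" "h n y = 0"
    using h_cross_self[of x y] h_cv[of "cross x y" "cv x"] h_cv[of "cross x y" "cv y"] h_eq_0_sym
    by (simp_all add: n_def del: h_cross_self cv_simps(6))
  have xn: "h x n = 0" "h y n = 0" using nx h_eq_0_sym by blast+
  have nn: "h n n = D"
  proof -
    \<comment> \<open>Lagrange's identity.\<close>
    have "h n n = h x x * h y y - h x y * h y x"
      by (simp add: n_def h_expand algebra_simps)
    then show ?thesis using x y by (simp add: hyx D_def flip: s_def)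
  qed
  \<comment> \<open>This is the norm that makes \<open>h v v = - a - b + g * cj g * D\<close> equal
    to -1.\<close>
  have "(a + b - 1) / D \<in> K" using D by (simp add: K_def a_def b_def cD field_simps)
  then obtain g where g: "g * cj g = (a + b - 1) / D" by (rule norm_surj)
  define v where "v = a *s x + b *s y + g *s n"
  have ab: "b * cj s = a - 1" "a * s = b - 1"
    using D by (simp_all add: a_def b_def D_def field_simps)
  have vx: "h v x = - 1" and vy: "h v y = - 1"
    using x y nx ab by (simp_all add: v_def hyx flip: s_def)
  have "h x v = - 1" "h y v = - 1"
    by (simp_all add: vx vy flip: h_cj[of v])
  moreover have "h n v = cj g * D" using nx by (simp add: v_def nn)
  ultimately have "h v v = - a - b + g * cj g * D"
    by (subst (1) v_def) simp
  also have "\<dots> = - 1" using D by (simp add: g)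
  finally show thesis using vx vy that by blast
qed

text \<open>Project a vector not orthogonal to \<open>z\<close> into the plane orthogonal to
  \<open>x\<close>. Adding a multiple of the isotropic \<open>z\<close> stays in this plane and
  changes the norm by an arbitrary trace.\<close>

lemma ex_orthogonal_unit:
  assumes x: "h x x = - 1" and z: "z \<noteq> 0" "h z z = 0" "h x z = 0"
  obtains v where "h v v = - 1" "h v x = 0"
proof -
  obtain w where w: "h z w \<noteq> 0" using h_nondegenerate z(1) by blast
  define f where "f = w + h w x *s x"
  have fx: "h f x = 0" using x by (simp add: f_def)
  have zx: "h z x = 0" using z(3) h_eq_0_sym by blast
  have zf: "h z f \<noteq> 0" using w zx by (simp add: f_def)
  have "- 1 - h f f \<in> K" by (intro K_closed h_self_K)
  then obtain t where t: "t + cj t = - 1 - h f f" by (rule trace_surj)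
  define v where "v = f + (t / h z f) *s z"
  have "h v x = 0" using fx zx by (simp add: v_def)
  moreover have "h v v = h f f + t + cj t"
    using z(2) zf h_cj[of z f] zf h_eq_0_sym[of f z] by (simp add: v_def algebra_simps)
  then have "h v v = - 1" using t by (simp add: algebra_simps)
  ultimately show thesis using that by blast
qed

text \<open>If \<open>h x y\<close> does not have norm 1, a common neighbour links the points.
  Otherwise a multiple \<open>k *s x\<close> is collinear with \<open>y\<close>, and a unit vector
  \<open>v\<close> orthogonal to \<open>x\<close> falls under the first case with both
  \<open>x\<close> and \<open>k *s x\<close>.\<close>

lemma constant_on_affine_points:
  assumes coll: "\<And>x u. h x x = - 1 \<Longrightarrow> h x u = 0 \<Longrightarrow> h u u = 0 \<Longrightarrow> C (x + u) = C x"
    and iso: "\<And>x. h x x = - 1 \<Longrightarrow> \<exists>z. z \<noteq> 0 \<and> h z z = 0 \<and> h x z = 0"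
    and x: "h x x = - 1" and y: "h y y = - 1"
  shows "C y = C x"
proof -
  have adj: "C b = C a" if "h a a = - 1" "h b b = - 1" "h a b = - 1" for a b
  proof -
    have "h b a = - 1" using that(3) h_cj[of a b] by simp
    then show ?thesis using coll[of a "b - a"] that by simp
  qed
  have gen: "C b = C a" if ab: "h a a = - 1" "h b b = - 1" "h a b * cj (h a b) \<noteq> 1" for a b
  proof -
    obtain v where "h v v = - 1" "h v a = - 1" "h v b = - 1"
      using ex_common_neighbour[OF ab] by blast
    then show ?thesis using adj[of v a] adj[of v b] ab by simp
  qed
  show ?thesis
  proof (cases "h x y * cj (h x y) = 1")
    case False then show ?thesis using gen x y by blast
  next
    case True
    define k where "k = - 1 / h x y"
    have k: "h (k *s x) (k *s x) = - 1" "h (k *s x) y = - 1"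
      using True x by (auto simp: k_def field_simps)
    obtain z where z: "z \<noteq> 0" "h z z = 0" "h x z = 0" using iso[OF x] by blast
    obtain v where v: "h v v = - 1" "h v x = 0" using ex_orthogonal_unit[OF x z] .
    have "C y = C (k *s x)" using adj k y by blast
    also have "\<dots> = C v" using gen[OF v(1) k(1)] v(2) by simp
    also have "\<dots> = C x" using gen[OF v(1) x] v(2) by simp
    finally show ?thesis .
  qed
qed

end

section \<open>Baer sublines and Baer subplanes in coordinates\<close>

lemma independent_pair:
  assumes "vec.independent {v, w :: 'a::field ^ 'n}" "v \<noteq> w" "a *s v + b *s w = 0"
  shows "a = 0 \<and> b = 0"
proof -
  let ?u = "\<lambda>y. if y = v then a else b"
  have sum: "(\<Sum>y\<in>{v, w}. ?u y *s y) = 0" using assms(2,3) by simp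
  have "?u v = 0" "?u w = 0"
    by (rule vec.independentD[OF assms(1) _ subset_refl sum]; simp)+
  then show ?thesis using assms(2) by simp
qed

lemma span_scale: "k \<noteq> 0 \<Longrightarrow> vec.span {k *s X} = vec.span {X :: 'a::field ^ 'n}"
proof -
  assume k: "k \<noteq> 0"
  have "k *s X \<in> vec.span {X}" by (intro vec.span_scale vec.span_base) simp
  moreover have "(1 / k) *s (k *s X) \<in> vec.span {k *s X}"
    by (intro vec.span_scale vec.span_base) simp
  then have "X \<in> vec.span {k *s X}" using k by (simp add: vector_smult_assoc)
  ultimately show ?thesis
    by (intro subset_antisym vec.span_minimal) auto
qed

lemma span_eq_imp_scale:
  assumes "vec.span {X :: 'a::field ^ 'n} = vec.span {Y}" "Y \<noteq> 0"
  obtains k where "k \<noteq> 0" "X = k *s Y"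
proof -
  have "X \<in> vec.span {Y}" using assms(1) vec.span_base[of X "{X}"] by simp
  then obtain k where k: "X = k *s Y" by (auto simp: vec.span_singleton)
  have "k \<noteq> 0"
  proof
    assume "k = 0"
    then have "vec.span {Y} = {0}" using k assms(1) by (simp add: vec.span_singleton)
    then have "Y \<in> {0}" using vec.span_base[of Y "{Y}"] by simp
    then show False using assms(2) by simp
  qed
  then show thesis using that k by blast
qed

section \<open>Homogeneous coordinates relative to the plane X_3 = 0\<close>

definition emb :: "'a::field ^ 3 \<Rightarrow> 'a \<Rightarrow> 'a ^ 4" where
  "emb x s = (\<chi> i. if i = 3 then s else x $ index_3 i)"

text \<open>Numerals wrap around in \<open>3\<close> and \<open>4\<close>: \<open>x $ 3\<close> is
  the coordinate X_0 of a vector over \<open>3\<close>, and index 4 plays this part over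
  \<open>4\<close>.\<close>

lemma index_0_eq_3: "(0 :: 3) = 3"
  using exhaust_3[of 0] by simp

lemma emb_nth [simp]:
  "emb x s $ 3 = s" "emb x s $ 1 = x $ 1" "emb x s $ 2 = x $ 2" "emb x s $ 0 = x $ 3" "emb x s $ 4 = x $ 3"
  by (simp_all add: emb_def index_3_def index_0_eq_3)

lemma emb_simps:
  "emb x s + emb y t = emb (x + y) (s + t)" "k *s emb x s = emb (k *s x) (k * s)"
  by (simp_all add: vec_eq_iff emb_def)

lemma emb_eq_iff [simp]: "emb x s = emb y t \<longleftrightarrow> x = y \<and> s = t"
  by (auto simp: vec_eq_iff forall_4 forall_3)

lemma emb_eq_0_iff [simp]: "emb x s = 0 \<longleftrightarrow> x = 0 \<and> s = 0"
  by (auto simp: vec_eq_iff forall_4 forall_3)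

lemma emb_surj: obtains x where "X = emb x (X $ 3)"
proof
  show "X = emb (vector [X $ 1, X $ 2, X $ 4]) (X $ 3)"
    by (simp add: vec_eq_iff forall_4)
qed

context gfq2
begin

lemma hform_emb: "hform q (emb x s) (emb y t) = h x y + s * cj t"
  by (simp add: hform_def sum_4 sum_3 cj_def)

text \<open>The affine point $(x, 1)$ and the point $(z, 0)$ span a line; its Baer sublines through
  these two points are obtained by rescaling $z$.\<close>

definition bsg :: "'a ^ 3 \<Rightarrow> 'a ^ 3 \<Rightarrow> ('a ^ 4) set set" where
  "bsg x z = insert (vec.span {emb z 0}) ((\<lambda>t. vec.span {emb (x + t *s z) 1}) ` K)"

lemma bsg_combination:
  assumes "r \<in> K" "s \<in> K" "r \<noteq> 0 \<or> s \<noteq> 0"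
  shows "vec.span {r *s emb x 1 + s *s emb z 0} \<in> bsg x z"
proof (cases "r = 0")
  case True
  then show ?thesis using assms(3) by (simp add: bsg_def span_scale)
next
  case False
  then have "r *s emb x 1 + s *s emb z 0 = r *s emb (x + (s / r) *s z) 1"
    by (simp add: emb_simps vec.scale_right_distrib vector_smult_assoc)
  then show ?thesis using False assms(1,2) K_closed(7) by (auto simp: bsg_def span_scale)
qed

lemma bsg_eq:
  "bsg x z = {vec.span {r *s emb x 1 + s *s emb z 0} | r s. r \<in> K \<and> s \<in> K \<and> (r \<noteq> 0 \<or> s \<noteq> 0)}"
  (is "_ = ?R")
proof
  have "vec.span {emb z 0} \<in> ?R"
    by (intro CollectI exI[of _ 0] exI[of _ 1]) (simp add: K_closed)
  moreover have "vec.span {emb (x + t *s z) 1} \<in> ?R" if "t \<in> K" for t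
    using that by (intro CollectI exI[of _ 1] exI[of _ t]) (simp add: K_closed emb_simps)
  ultimately show "bsg x z \<subseteq> ?R" by (auto simp: bsg_def)
qed (auto intro: bsg_combination)

text \<open>One inclusion holds for all scalars; applying it to the inverse scalar gives the
  other.\<close>

lemma bsg_scale:
  assumes "k \<in> K" "k \<noteq> 0" shows "bsg x (k *s z) = bsg x z"
proof -
  have *: "bsg x (k *s z) \<subseteq> bsg x z" if "k \<in> K" "k \<noteq> 0" for k z
  proof -
    have "emb (k *s z) 0 = k *s emb z 0" by (simp add: emb_simps)
    then have "vec.span {emb (k *s z) 0} = vec.span {emb z 0}" using that(2) span_scale by metis
    moreover have "x + t *s (k *s z) = x + (t * k) *s z" for t by (simp add: vector_smult_assoc)
    ultimately show ?thesis using that(1) K_closed(4) unfolding bsg_def by auto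
  qed
  have "bsg x ((1 / k) *s (k *s z)) \<subseteq> bsg x (k *s z)"
    using assms K_closed(2,7) by (intro *) auto
  then show ?thesis using * assms by (auto simp: vector_smult_assoc)
qed

lemma bsg_translate:
  assumes "k \<in> K" shows "bsg (x + k *s z) z = bsg x z"
proof -
  have *: "bsg (x + k *s z) z \<subseteq> bsg x z" if "k \<in> K" for k x
  proof -
    have "vec.span {emb (x + k *s z + t *s z) 1} \<in> bsg x z" if t: "t \<in> K" for t
    proof -
      have "vec.span {emb (x + (k + t) *s z) 1} \<in> bsg x z"
        unfolding bsg_def using K_closed(3)[OF \<open>k \<in> K\<close> t] by blast
      then show ?thesis by (simp add: vec.scale_left_distrib add.assoc)
    qed
    moreover have "vec.span {emb z 0} \<in> bsg x z" by (simp add: bsg_def)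
    ultimately show ?thesis unfolding bsg_def[of "x + k *s z"] by blast
  qed
  have "bsg (x + k *s z + (- k) *s z) z \<subseteq> bsg (x + k *s z) z"
    using assms K_closed(6) by (intro *) auto
  then show ?thesis using * assms by auto
qed

lemma affine_point_in_bsg: "vec.span {emb x 1} \<in> bsg x z"
  using K_closed(1) by (force simp: bsg_def)

lemma baer_subline_basis:
  fixes b :: "('a ^ 'n) set set"
  assumes "baer_subline q b"
  obtains v w where "\<forall>r s. r *s v + s *s w = 0 \<longrightarrow> r = 0 \<and> s = 0"
    and "b = {vec.span {r *s v + s *s w} | r s. r \<in> K \<and> s \<in> K \<and> (r \<noteq> 0 \<or> s \<noteq> 0)}"
proof -
  obtain B where B: "vec.independent B" "card B = 2"
    and b: "b = {vec.span {\<Sum>v\<in>B. c v *s v} | c. (\<forall>v\<in>B. c v \<in> K) \<and> (\<exists>v\<in>B. c v \<noteq> 0)}"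
    using assms by (auto simp: baer_subline_def baer_subgeometry_def K_GF_sub)
  obtain v w where vw: "B = {v, w}" "v \<noteq> w" using B(2) by (auto simp: card_2_iff)
  have "b = {vec.span {r *s v + s *s w} | r s. r \<in> K \<and> s \<in> K \<and> (r \<noteq> 0 \<or> s \<noteq> 0)}" (is "_ = ?R")
  proof
    show "b \<subseteq> ?R"
    proof
      fix P assume "P \<in> b"
      then obtain c where c: "P = vec.span {\<Sum>v\<in>B. c v *s v}" "\<forall>v\<in>B. c v \<in> K" "\<exists>v\<in>B. c v \<noteq> 0"
        unfolding b by blast
      have "(\<Sum>v\<in>B. c v *s v) = c v *s v + c w *s w" using vw by simp
      then show "P \<in> ?R" using c vw(1) by auto
    qed
    show "?R \<subseteq> b"
    proof
      fix P assume "P \<in> ?R"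
      then obtain r s where P: "P = vec.span {r *s v + s *s w}" "r \<in> K" "s \<in> K" "r \<noteq> 0 \<or> s \<noteq> 0"
        by blast
      let ?c = "\<lambda>y. if y = v then r else s"
      have "(\<Sum>y\<in>B. ?c y *s y) = r *s v + s *s w" using vw by simp
      moreover have "\<exists>y\<in>B. ?c y \<noteq> 0" using vw P(4) by (cases "r = 0") auto
      moreover have "\<forall>y\<in>B. ?c y \<in> K" using P by simp
      ultimately show "P \<in> b" unfolding b P(1) by (intro CollectI exI[of _ ?c]) metis
    qed
  qed
  then show thesis using that independent_pair[of v w] B(1) vw by blast
qed

text \<open>A change of basis over GF(q): the given points have representatives \<open>X\<close> and
  \<open>Z\<close> in the GF(q)-span of \<open>v\<close> and \<open>w\<close>, with coefficient
  determinant \<open>D\<close>.\<close>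

lemma baer_subline_eq_bsg:
  assumes b: "baer_subline q b" and P: "P \<in> b" "\<And>X. X \<in> P \<Longrightarrow> X $ 3 = 0"
    and x: "vec.span {emb x 1} \<in> b"
  obtains z where "z \<noteq> 0" "b = bsg x z"
proof -
  obtain v w where ind: "\<forall>r s. r *s v + s *s w = 0 \<longrightarrow> r = 0 \<and> s = 0"
    and b: "b = {vec.span {r *s v + s *s w} | r s. r \<in> K \<and> s \<in> K \<and> (r \<noteq> 0 \<or> s \<noteq> 0)}"
    using baer_subline_basis[OF b] .
  obtain c1 c2 where c: "P = vec.span {c1 *s v + c2 *s w}" "c1 \<in> K" "c2 \<in> K" "c1 \<noteq> 0 \<or> c2 \<noteq> 0"
    using P(1) b by blast
  define Z where "Z = c1 *s v + c2 *s w"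
  have "Z \<in> P" unfolding c(1) Z_def by (rule vec.span_base) simp
  then have "Z $ 3 = 0" by (rule P(2))
  moreover obtain z' where "Z = emb z' (Z $ 3)" using emb_surj .
  ultimately have z': "Z = emb z' 0" by simp
  have Z0: "Z \<noteq> 0" using ind c(4) by (auto simp: Z_def)
  obtain d1 d2 where d: "vec.span {d1 *s v + d2 *s w} = vec.span {emb x 1}" "d1 \<in> K" "d2 \<in> K"
    using x b by blast
  define X where "X = d1 *s v + d2 *s w"
  obtain l where l: "l \<noteq> 0" "X = l *s emb x 1"
    using span_eq_imp_scale[OF d(1)] by (auto simp: X_def)
  define D where "D = d1 * c2 - d2 * c1"
  have DK: "D \<in> K" using c d K_closed by (simp add: D_def)
  have "D \<noteq> 0"
  \<comment> \<open>Otherwise \<open>X\<close> and \<open>Z\<close> would be proportional, but only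
    \<open>X\<close> has a nonzero last coordinate.\<close>
  proof
    assume D: "D = 0"
    have "c2 *s X - d2 *s Z = D *s v" "d1 *s Z - c1 *s X = D *s w"
      by (simp_all add: X_def Z_def D_def vec_eq_iff algebra_simps)
    then have "c2 *s X = d2 *s Z" "c1 *s X = d1 *s Z" using D by simp_all
    then have "c2 * l = 0" "c1 * l = 0" by (simp_all add: l(2) z' emb_simps)
    then show False using l(1) c(4) by simp
  qed
  \<comment> \<open>\<open>X\<close> and \<open>Z\<close> are divided by the same \<open>l\<close>,
    so that their GF(q)-combinations keep spanning the same points.\<close>
  define z where "z = (1 / l) *s z'"
  have Zl: "Z = l *s emb z 0" using l(1) by (simp add: z' z_def emb_simps vector_smult_assoc)
  have sp: "vec.span {r *s X + s *s Z} = vec.span {r *s emb x 1 + s *s emb z 0}" for r s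
  proof -
    have "r *s X + s *s Z = l *s (r *s emb x 1 + s *s emb z 0)"
      by (simp add: l(2) Zl vec_eq_iff algebra_simps)
    then show ?thesis using span_scale[OF l(1)] by metis
  qed
  have "b = bsg x z"
  proof
    show "b \<subseteq> bsg x z"
    proof
      fix Q assume "Q \<in> b"
      then obtain e1 e2 where e: "Q = vec.span {e1 *s v + e2 *s w}" "e1 \<in> K" "e2 \<in> K" "e1 \<noteq> 0 \<or> e2 \<noteq> 0"
        using b by blast
      \<comment> \<open>Cramer's rule for
        \<open>r *s X + s *s Z = e1 *s v + e2 *s w\<close>.\<close>
      define r where "r = (e1 * c2 - e2 * c1) / D"
      define s where "s = (d1 * e2 - d2 * e1) / D"
      have "D *s (r *s X + s *s Z) = (D * r) *s X + (D * s) *s Z"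
        by (simp add: vec.scale_right_distrib vector_smult_assoc)
      also have "\<dots> = D *s (e1 *s v + e2 *s w)"
        using \<open>D \<noteq> 0\<close> by (simp add: r_def s_def) (simp add: D_def X_def Z_def vec_eq_iff algebra_simps)
      finally have Y: "r *s X + s *s Z = e1 *s v + e2 *s w"
        by (rule vec.scale_left_imp_eq[OF \<open>D \<noteq> 0\<close>])
      have "r \<noteq> 0 \<or> s \<noteq> 0"
      proof (rule ccontr)
        assume "\<not> ?thesis"
        then have "e1 *s v + e2 *s w = 0" by (simp flip: Y)
        then show False using ind e(4) by blast
      qed
      moreover have "r \<in> K" "s \<in> K" using c d e DK K_closed by (simp_all add: r_def s_def)
      moreover have "Q = vec.span {r *s emb x 1 + s *s emb z 0}"
        unfolding e(1) Y[symmetric] sp ..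
      ultimately show "Q \<in> bsg x z" using bsg_combination by simp
    qed
    show "bsg x z \<subseteq> b"
    proof
      fix Q assume "Q \<in> bsg x z"
      then obtain r s where rs: "Q = vec.span {r *s emb x 1 + s *s emb z 0}" "r \<in> K" "s \<in> K" "r \<noteq> 0 \<or> s \<noteq> 0"
        unfolding bsg_eq by blast
      have Y: "r *s X + s *s Z = (r * d1 + s * c1) *s v + (r * d2 + s * c2) *s w"
        by (simp add: X_def Z_def vec_eq_iff algebra_simps)
      have "r * d1 + s * c1 \<noteq> 0 \<or> r * d2 + s * c2 \<noteq> 0"
      proof (rule ccontr)
        assume "\<not> ?thesis"
        then have n: "r * d1 + s * c1 = 0" "r * d2 + s * c2 = 0" by auto
        have "r * D = (r * d1 + s * c1) * c2 - (r * d2 + s * c2) * c1"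
          "s * D = (r * d2 + s * c2) * d1 - (r * d1 + s * c1) * d2" by (simp_all add: D_def algebra_simps)
        then show False using n \<open>D \<noteq> 0\<close> rs(4) by simp
      qed
      moreover have "r * d1 + s * c1 \<in> K" "r * d2 + s * c2 \<in> K" using rs c d K_closed by simp_all
      moreover have "Q = vec.span {(r * d1 + s * c1) *s v + (r * d2 + s * c2) *s w}"
        unfolding rs(1) sp[symmetric] Y ..
      ultimately show "Q \<in> b" unfolding b by blast
    qed
  qed
  moreover have "z \<noteq> 0" using Z0 Zl by auto
  ultimately show thesis using that by blast
qed

text \<open>\<open>W\<close> is the GF(q)-span of the basis. Coordinates of vectors in
  \<open>W\<close> are fixed by conjugation, so replacing \<open>r\<close> and \<open>s\<close> by
  their conjugates leaves the combination unchanged.\<close>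

lemma baer_subplane_vectors:
  fixes \<pi> :: "('a ^ 'n) set set"
  assumes "baer_subplane q \<pi>"
  obtains W where "\<And>P. P \<in> \<pi> \<Longrightarrow> \<exists>Y\<in>W. P = vec.span {Y}" "\<And>Y k. Y \<in> W \<Longrightarrow> k \<in> K \<Longrightarrow> k *s Y \<in> W"
    "\<And>Y1 Y2 r s. Y1 \<in> W \<Longrightarrow> Y2 \<in> W \<Longrightarrow> r *s Y1 + s *s Y2 \<in> W
      \<Longrightarrow> (r - cj r) *s Y1 + (s - cj s) *s Y2 = 0"
proof -
  obtain B :: "('a ^ 'n) set" where B: "vec.independent B" "card B = 3"
    and \<pi>: "\<pi> = {vec.span {\<Sum>v\<in>B. c v *s v} | c. (\<forall>v\<in>B. c v \<in> K) \<and> (\<exists>v\<in>B. c v \<noteq> 0)}"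
    using assms by (auto simp: baer_subplane_def baer_subgeometry_def K_GF_sub)
  define W where "W = {\<Sum>v\<in>B. c v *s v | c. \<forall>v\<in>B. c v \<in> K}"
  have fin: "finite B" using B(2) by (simp add: card_ge_0_finite)
  show thesis
  proof (rule that[of W])
    show "\<exists>Y\<in>W. P = vec.span {Y}" if "P \<in> \<pi>" for P using that unfolding \<pi> W_def by blast
    show "k *s Y \<in> W" if "Y \<in> W" "k \<in> K" for Y k
    proof -
      obtain c where c: "Y = (\<Sum>v\<in>B. c v *s v)" "\<forall>v\<in>B. c v \<in> K" using \<open>Y \<in> W\<close> W_def by auto
      have "k *s Y = (\<Sum>v\<in>B. (k * c v) *s v)"
        by (simp add: c(1) vec.scale_sum_right vector_smult_assoc)
      then show ?thesis using c(2) that(2) K_closed(4)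
        unfolding W_def by (intro CollectI exI[of _ "\<lambda>v. k * c v"]) simp
    qed
    show "(r - cj r) *s Y1 + (s - cj s) *s Y2 = 0"
      if Y: "Y1 \<in> W" "Y2 \<in> W" "r *s Y1 + s *s Y2 \<in> W" for Y1 Y2 r s
    proof -
      obtain c where c: "Y1 = (\<Sum>v\<in>B. c v *s v)" "\<forall>v\<in>B. c v \<in> K" using Y(1) W_def by auto
      obtain d where d: "Y2 = (\<Sum>v\<in>B. d v *s v)" "\<forall>v\<in>B. d v \<in> K" using Y(2) W_def by auto
      obtain e where e: "r *s Y1 + s *s Y2 = (\<Sum>v\<in>B. e v *s v)" "\<forall>v\<in>B. e v \<in> K" using Y(3) W_def by auto
      have comb: "r *s Y1 + s *s Y2 = (\<Sum>v\<in>B. (r * c v + s * d v) *s v)" for r s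
        by (simp add: c(1) d(1) vec.scale_sum_right vector_smult_assoc vec.scale_left_distrib sum.distrib)
      have "(\<Sum>v\<in>B. (r * c v + s * d v - e v) *s v) = 0"
        using comb[of r s] e(1) by (simp add: vec.scale_left_diff_distrib sum_subtractf)
      then have 0: "r * c v + s * d v = e v" if "v \<in> B" for v
        using vec.independentD[OF B(1) fin subset_refl _ that] by fastforce
      have "(r - cj r) * c v + (s - cj s) * d v = 0" if v: "v \<in> B" for v
      proof -
        have "cj r * c v + cj s * d v = e v"
          using arg_cong[OF 0[OF v], of cj] c(2) d(2) e(2) v by (simp add: K_def)
        then show ?thesis using 0[OF v] by (simp add: algebra_simps)
      qed
      then show ?thesis unfolding comb by (simp add: sum.neutral)
    qed
  qed
qed

text \<open>One scalar \<open>l\<close> brings both \<open>emb x 1\<close> and all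
  \<open>emb z 0\<close> into the GF(q)-space of the subplane, so the directions themselves lie in a
  GF(q)-space up to a common factor.\<close>

lemma baer_subplane_directions:
  assumes \<pi>: "baer_subplane q \<pi>" and S: "\<And>z. z \<in> S \<Longrightarrow> bsg x z \<subseteq> \<pi>"
    and z: "z1 \<in> S" "z2 \<in> S" "r *s z1 + s *s z2 \<in> S" "0 \<notin> S"
  shows "(r - cj r) *s z1 + (s - cj s) *s z2 = 0"
proof -
  obtain W where W: "\<And>P. P \<in> \<pi> \<Longrightarrow> \<exists>Y\<in>W. P = vec.span {Y}"
    and Wk: "\<And>Y k. Y \<in> W \<Longrightarrow> k \<in> K \<Longrightarrow> k *s Y \<in> W"
    and Wc: "\<And>Y1 Y2 r s. Y1 \<in> W \<Longrightarrow> Y2 \<in> W \<Longrightarrow> r *s Y1 + s *s Y2 \<in> W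
      \<Longrightarrow> (r - cj r) *s Y1 + (s - cj s) *s Y2 = 0"
    using baer_subplane_vectors[OF \<pi>] by blast
  have point: "\<exists>k. k \<noteq> 0 \<and> k *s Y \<in> W" if Y: "vec.span {Y} \<in> \<pi>" "Y \<noteq> 0" for Y
  proof -
    obtain Y' where Y': "Y' \<in> W" "vec.span {Y} = vec.span {Y'}" using W[OF Y(1)] by blast
    then show ?thesis using span_eq_imp_scale[OF Y'(2)[symmetric] Y(2)] by metis
  qed
  have "vec.span {emb x 1} \<in> \<pi>" using S[OF z(1)] affine_point_in_bsg by blast
  then obtain l where l: "l \<noteq> 0" "l *s emb x 1 \<in> W" using point[of "emb x 1"] by auto
  have dir: "l *s emb z 0 \<in> W" if "z \<in> S" for z
  proof -
    have z0: "z \<noteq> 0" using that z(4) by auto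
    have "vec.span {emb z 0} \<in> \<pi>" using S[OF that] by (auto simp: bsg_def)
    then obtain k where k: "k \<noteq> 0" "k *s emb z 0 \<in> W" using point[of "emb z 0"] z0 by auto
    \<comment> \<open>A third point of the subline compares the scalings \<open>l\<close> of
      \<open>emb x 1\<close> and \<open>k\<close> of \<open>emb z 0\<close>: it forces
      \<open>l / k\<close> into GF(q).\<close>
    have "vec.span {emb (x + 1 *s z) 1} \<in> \<pi>"
      using S[OF that] K_closed(2) unfolding bsg_def by blast
    then obtain m where m: "m \<noteq> 0" "m *s emb (x + z) 1 \<in> W" using point[of "emb (x + z) 1"] by auto
    have "m *s emb (x + z) 1 = (m / l) *s (l *s emb x 1) + (m / k) *s (k *s emb z 0)"
      using l(1) k(1) by (simp add: emb_simps vector_smult_assoc vec.scale_right_distrib)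
    then have "(m / l) *s (l *s emb x 1) + (m / k) *s (k *s emb z 0) \<in> W" using m(2) by metis
    then have *: "(m / l - cj (m / l)) *s (l *s emb x 1) + (m / k - cj (m / k)) *s (k *s emb z 0) = 0"
      by (rule Wc[OF l(2) k(2)])
    have "(m / l - cj (m / l)) * l = 0" using * by (simp only: emb_simps emb_eq_0_iff) simp
    then have ml: "m / l \<in> K" using l(1) by (simp add: K_def del: cj_divide)
    then have "(m / k - cj (m / k)) *s (k *s emb z 0) = 0" using * by (simp add: K_def del: cj_divide)
    then have "(m / k - cj (m / k)) *s (k *s z) = 0" by (simp only: emb_simps emb_eq_0_iff)
    then have mk: "m / k \<in> K" using z0 k(1) by (simp add: K_def del: cj_divide)
    have "((m / k) / (m / l)) *s (k *s emb z 0) \<in> W" using ml mk K_closed(7) Wk k(2) by blast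
    then show ?thesis using m(1) k(1) l(1) by (simp add: vector_smult_assoc)
  qed
  have "l *s emb (r *s z1 + s *s z2) 0 = r *s (l *s emb z1 0) + s *s (l *s emb z2 0)"
    by (simp add: emb_simps vec_eq_iff algebra_simps)
  then have "r *s (l *s emb z1 0) + s *s (l *s emb z2 0) \<in> W" using dir[OF z(3)] by metis
  then have "(r - cj r) *s (l *s emb z1 0) + (s - cj s) *s (l *s emb z2 0) = 0"
    by (rule Wc[OF dir[OF z(1)] dir[OF z(2)]])
  then have "(r - cj r) *s (l *s z1) + (s - cj s) *s (l *s z2) = 0"
    by (simp only: emb_simps emb_eq_0_iff)
  then have "l *s ((r - cj r) *s z1 + (s - cj s) *s z2) = 0"
    by (simp add: vec_eq_iff algebra_simps)
  then show ?thesis using l(1) vec.scale_eq_0_iff by blast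
qed

end

lemma not_parallel_imp_independent:
  fixes z w :: "'a::field ^ 'n"
  assumes "z \<noteq> 0" "\<And>k. w \<noteq> k *s z" "a *s z + b *s w = 0"
  shows "a = 0 \<and> b = 0"
proof -
  have "b = 0"
  proof (rule ccontr)
    assume b: "b \<noteq> 0"
    have "b *s w = - (a *s z)" using assms(3) by (simp add: eq_neg_iff_add_eq_0 add.commute)
    then have "(1 / b) *s (b *s w) = (- a / b) *s z" by (simp add: vector_smult_assoc)
    then show False using b assms(2)[of "- a / b"] by (simp add: vector_smult_assoc)
  qed
  then show ?thesis using assms(1,3) by simp
qed

context gfq2
begin

lemma cv_combination_eq_0:
  assumes "a *s cv z + b *s cv w = 0" shows "cj a *s z + cj b *s w = 0"
  using arg_cong[OF assms, of cv] cv_simps(7)[of 0] by simp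

lemma affine_vector_exists: obtains x where "h x x = - 1"
proof -
  obtain g where "g * cj g = - 1" using norm_surj[of "- 1"] K_closed(2,6) by blast
  then have "h (axis 1 g) (axis 1 g) = - 1" by (simp add: h_expand axis_def)
  then show thesis by (rule that)
qed

lemma affine_point_affine:
  assumes "h x x = - 1" shows "vec.span {emb x 1} \<in> affine_points q"
proof -
  have "vec.dim (vec.span {emb x 1}) = 1"
    using vec.dim_eq_card_independent[of "{emb x 1}"] by (simp add: vec.dim_span)
  moreover have "hform q X X = 0" if "X \<in> vec.span {emb x 1}" for X
    using that assms by (auto simp: vec.span_singleton emb_simps hform_emb algebra_simps)
  moreover have "emb x 1 \<in> vec.span {emb x 1}" by (intro vec.span_base) simp
  then have "\<exists>X\<in>vec.span {emb x 1}. X $ 3 \<noteq> 0" by (intro bexI[of _ "emb x 1"]) simp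
  ultimately show ?thesis
    by (auto simp: affine_points_def hermitian_surface_def hermitian_curve_def pg_point_def)
qed

lemma bsg_isotropic:
  assumes "baer_subgenerator q (bsg x z)"
  shows "h x x = - 1" "h x z = 0" "h z z = 0"
proof -
  obtain L where L: "generator q L" "\<And>P. P \<in> bsg x z \<Longrightarrow> P \<subseteq> L"
    using assms by (auto simp: baer_subgenerator_def)
  have "emb x 1 \<in> L"
    using L(2)[OF affine_point_in_bsg] vec.span_base[of "emb x 1" "{emb x 1}"] by blast
  moreover have "vec.span {emb z 0} \<in> bsg x z" by (simp add: bsg_def)
  then have "emb z 0 \<in> L"
    using L(2) vec.span_base[of "emb z 0" "{emb z 0}"] by blast
  ultimately have "hform q (emb x 1) (emb x 1) = 0" "hform q (emb x 1) (emb z 0) = 0"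
    "hform q (emb z 0) (emb z 0) = 0"
    using L(1) by (auto simp: generator_def)
  then show "h x x = - 1" "h x z = 0" "h z z = 0"
    by (simp_all add: hform_emb eq_neg_iff_add_eq_0)
qed

text \<open>If \<open>cross u w\<close> were nonzero, both conjugates would be multiples of it and
  hence parallel. So no generator lies in the plane X_3 = 0.\<close>

lemma totally_isotropic_parallel:
  assumes "u \<noteq> 0" "h u u = 0" "h w u = 0" "h w w = 0"
  obtains k where "w = k *s u"
proof (cases "cross u w = 0")
  case True then show ?thesis using assms(1) cross_eq_0_imp_parallel that by blast
next
  case False
  have "cross (cross u w) (cv u) = 0" "cross (cross u w) (cv w) = 0"
    using assms(2-4) h_eq_0_sym[of u w] by (simp_all add: cross_cross_cv)
  then obtain a b where ab: "cv u = a *s cross u w" "cv w = b *s cross u w"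
    using False cross_eq_0_imp_parallel by metis
  have "a \<noteq> 0" using ab(1) assms(1) by (metis cv_simps(7) vec.scale_zero_left)
  then have "cv w = (b / a) *s cv u" by (simp add: ab vector_smult_assoc)
  then have "cv (cv w) = cv ((b / a) *s cv u)" by simp
  then show ?thesis using that[of "cj (b / a)"] by simp
qed

lemma baer_subgenerator_affine_point:
  assumes "baer_subgenerator q b"
  obtains x where "h x x = - 1" "vec.span {emb x 1} \<in> b"
proof -
  obtain L where b: "baer_subline q b" and L: "generator q L" "\<And>P. P \<in> b \<Longrightarrow> P \<subseteq> L"
    using assms by (auto simp: baer_subgenerator_def)
  obtain v w where ind: "\<forall>r s. r *s v + s *s w = 0 \<longrightarrow> r = 0 \<and> s = 0"
    and b: "b = {vec.span {r *s v + s *s w} | r s. r \<in> K \<and> s \<in> K \<and> (r \<noteq> 0 \<or> s \<noteq> 0)}"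
    using baer_subline_basis[OF b] .
  have vb: "vec.span {v} \<in> b"
    unfolding b by (intro CollectI exI[of _ 1] exI[of _ 0]) (simp add: K_closed)
  have wb: "vec.span {w} \<in> b"
    unfolding b by (intro CollectI exI[of _ 0] exI[of _ 1]) (simp add: K_closed)
  have vwL: "v \<in> L" "w \<in> L"
    using L(2)[OF vb] L(2)[OF wb] vec.span_base[of v "{v}"] vec.span_base[of w "{w}"] by auto
  have L0: "hform q X Y = 0" if "X \<in> L" "Y \<in> L" for X Y
    using L(1) that by (auto simp: generator_def)
  have aff: "\<exists>x. h x x = - 1 \<and> vec.span {emb x 1} \<in> b" if X: "X \<in> L" "vec.span {X} \<in> b" "X $ 3 \<noteq> 0" for X
  proof -
    obtain y where y: "X = emb y (X $ 3)" by (rule emb_surj)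
    define x where "x = (1 / X $ 3) *s y"
    have Xx: "X = (X $ 3) *s emb x 1"
      using X(3) y by (simp add: x_def emb_simps vector_smult_assoc)
    have "hform q (X $ 3 *s emb x 1) (X $ 3 *s emb x 1) = 0"
      using L0[OF X(1,1)] Xx by metis
    then have "X $ 3 * (cj (X $ 3) * (h x x + 1)) = 0"
      by (simp add: emb_simps hform_emb algebra_simps)
    then have "h x x = - 1" using X(3) by (simp add: eq_neg_iff_add_eq_0)
    moreover have "vec.span {emb x 1} = vec.span {X}" using Xx span_scale[OF X(3)] by metis
    ultimately show ?thesis using X(2) by auto
  qed
  show thesis
  proof (cases "v $ 3 = 0 \<and> w $ 3 = 0")
    case False then show ?thesis using aff vb wb vwL that by blast
  next
    case True
    obtain v' where "v = emb v' (v $ 3)" by (rule emb_surj)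
    moreover obtain w' where "w = emb w' (w $ 3)" by (rule emb_surj)
    ultimately have vw: "v = emb v' 0" "w = emb w' 0" using True by simp_all
    have "v \<noteq> 0" using ind[rule_format, of 1 0] by auto
    then have "v' \<noteq> 0" by (simp add: vw)
    moreover have "h y y' = 0" if "emb y 0 \<in> L" "emb y' 0 \<in> L" for y y'
      using L0[OF that] by (simp add: hform_emb)
    then have "h v' v' = 0" "h w' v' = 0" "h w' w' = 0"
      using vwL by (simp_all add: vw)
    ultimately obtain k where "w' = k *s v'" by (rule totally_isotropic_parallel)
    then have "k *s v + (- 1) *s w = 0" by (simp add: vw emb_simps)
    then show ?thesis using ind[rule_format, of k "- 1"] by simp
  qed
qed

end

section \<open>Families of Baer subgenerators\<close>

locale baer_subgenerator_family = gfq2 q T for q and T :: "'a::{field,finite} itself" +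
  fixes \<Omega> :: "('a ^ 4) set set set"
  assumes subgenerator: "b \<in> \<Omega> \<Longrightarrow> baer_subgenerator q b"
    and meets_curve: "b \<in> \<Omega> \<Longrightarrow> b \<inter> hermitian_curve q \<noteq> {}"
    and card_through: "P \<in> affine_points q \<Longrightarrow> card {b \<in> \<Omega>. P \<in> b} = q + 1"
    and spans_subplane: "P \<in> affine_points q \<Longrightarrow> spans_baer_subplane q {b \<in> \<Omega>. P \<in> b}"
begin

lemma member_eq_bsg:
  assumes "b \<in> \<Omega>" "vec.span {emb x 1} \<in> b"
  obtains z where "z \<noteq> 0" "b = bsg x z"
proof -
  obtain P where "P \<in> b" "P \<in> hermitian_curve q" using meets_curve[OF assms(1)] by blast
  moreover have "baer_subline q b" using subgenerator[OF assms(1)] by (simp add: baer_subgenerator_def)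
  ultimately show thesis
    using baer_subline_eq_bsg[of b P x] assms(2) that by (auto simp: hermitian_curve_def)
qed

text \<open>These are vectors, not points: the elements of \<open>\<Omega>\<close> through
  \<open>x\<close> correspond to their classes modulo nonzero scalars of GF(q).\<close>

definition dirs :: "'a ^ 3 \<Rightarrow> ('a ^ 3) set" where
  "dirs x = {z. z \<noteq> 0 \<and> bsg x z \<in> \<Omega>}"

lemma through_eq_image_dirs: "{b \<in> \<Omega>. vec.span {emb x 1} \<in> b} = bsg x ` dirs x"
proof (intro subset_antisym subsetI)
  fix b assume b: "b \<in> {b \<in> \<Omega>. vec.span {emb x 1} \<in> b}"
  then obtain z where "z \<noteq> 0" "b = bsg x z" using member_eq_bsg[of b x] by auto
  then show "b \<in> bsg x ` dirs x" using b by (simp add: dirs_def)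
qed (auto simp: dirs_def affine_point_in_bsg)

lemma card_image_dirs: "h x x = - 1 \<Longrightarrow> card (bsg x ` dirs x) = q + 1"
  using card_through[OF affine_point_affine] through_eq_image_dirs by simp

lemma dirs_combination:
  assumes "h x x = - 1" "z1 \<in> dirs x" "z2 \<in> dirs x" "r *s z1 + s *s z2 \<in> dirs x"
  shows "(r - cj r) *s z1 + (s - cj s) *s z2 = 0"
proof -
  obtain \<pi> where "baer_subplane q \<pi>" "\<Union> (bsg x ` dirs x) \<subseteq> \<pi>"
    using spans_subplane[OF affine_point_affine[OF assms(1)]] through_eq_image_dirs
    by (auto simp: spans_baer_subplane_def)
  then show ?thesis
    using assms(2-4) by (intro baer_subplane_directions[of \<pi> "dirs x" x]) (auto simp: dirs_def)
qed

text \<open>The case \<open>s = 0\<close> of \<open>dirs_combination\<close>: a generator through an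
  affine point carries at most one element of \<open>\<Omega>\<close> through that point.\<close>

lemma dirs_scale_imp_K:
  assumes "h x x = - 1" "z \<in> dirs x" "k *s z \<in> dirs x"
  shows "k \<in> K" "k \<noteq> 0"
proof -
  have "(k - cj k) *s z + (0 - cj 0) *s z = 0"
    using assms by (intro dirs_combination[of x z z k 0]) simp_all
  moreover have "z \<noteq> 0" using assms(2) by (simp add: dirs_def)
  ultimately show "k \<in> K" by (simp add: K_def)
  show "k \<noteq> 0" using assms(3) by (auto simp: dirs_def)
qed

lemma dirs_rel:
  assumes "h x x = - 1" "z \<in> dirs x"
  obtains c where "c * cj c = 1" "rel c x z"
proof -
  have z: "z \<noteq> 0" "bsg x z \<in> \<Omega>" using assms(2) by (simp_all add: dirs_def)
  show thesis
    using rel_exists[OF assms(1) z(1) bsg_isotropic(3,2)[OF subgenerator[OF z(2)]]] that by blast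
qed

lemma dirs_coordinates:
  assumes x: "h x x = - 1" and z: "z \<in> dirs x" "w \<in> dirs x" "\<And>k. w \<noteq> k *s z" and v: "h v x = 0"
  obtains a b where "v = a *s z + b *s w"
proof -
  obtain c where c: "c * cj c = 1" "rel c x z" using dirs_rel[OF x z(1)] .
  obtain d where d: "d * cj d = 1" "rel d x w" using dirs_rel[OF x z(2)] .
  have nz: "c \<noteq> 0" "d \<noteq> 0" "z \<noteq> 0" using c d z by (auto simp: dirs_def)
  have "h w z \<noteq> 0"
  proof
    assume "h w z = 0"
    moreover have "h w x = 0" using rel_orthogonal[OF d(2) nz(2)] h_eq_0_sym by blast
    ultimately show False using rel_perp_parallel[OF c(2) nz(1,3)] z(3) by blast
  qed
  then show thesis using rel_plane_coordinates[OF c(2) nz(1,3) d(2) nz(2) _ v] that by blast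
qed

text \<open>For nonparallel \<open>z\<close> and \<open>w\<close> take a third direction
  \<open>v = a *s z + b *s w\<close>. The Baer subplane puts \<open>a\<close> and \<open>b\<close>
  in GF(q), so comparing two expressions for \<open>cross x v\<close> shows that both constants
  equal that of \<open>v\<close>.\<close>

lemma dirs_rel_eq:
  assumes x: "h x x = - 1" and z: "z \<in> dirs x" "w \<in> dirs x" and c: "rel c x z" and d: "rel d x w"
  shows "d = c"
proof (cases "\<exists>k. w = k *s z")
  case True
  then obtain k where k: "w = k *s z" ..
  then have "rel c x w" using rel_scale[OF c] dirs_scale_imp_K[OF x z(1)] z(2) by simp
  then show ?thesis using rel_unique d z(2) by (auto simp: dirs_def)
next
  case False
  \<comment> \<open>A third element exists because q + 1 > 2.\<close>
  have "card {bsg x z, bsg x w} < card (bsg x ` dirs x)"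
    unfolding card_image_dirs[OF x] using q_gt_1 by (simp add: card_insert_if)
  then have "\<not> bsg x ` dirs x \<subseteq> {bsg x z, bsg x w}" by (meson card_mono finite leD)
  then obtain v where v: "v \<in> dirs x" "bsg x v \<noteq> bsg x z" "bsg x v \<noteq> bsg x w" by auto
  obtain e where e: "e * cj e = 1" "rel e x v" using dirs_rel[OF x v(1)] .
  have vx: "h v x = 0" using rel_orthogonal[OF e(2)] e(1) h_eq_0_sym by force
  obtain a b where ab: "v = a *s z + b *s w" using dirs_coordinates[OF x z _ vx] False by blast
  have z0: "z \<noteq> 0" using z(1) by (simp add: dirs_def)
  have ind: "s = 0 \<and> t = 0" if "s *s z + t *s w = 0" for s t
    using not_parallel_imp_independent[OF z0 _ that] False by blast
  have "a - cj a = 0 \<and> b - cj b = 0"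
    using dirs_combination[OF x z] v(1) ab by (intro ind) simp
  then have K: "cj a = a" "cj b = b" by simp_all
  have "a \<noteq> 0"
  proof
    assume "a = 0"
    then have "v = b *s w" using ab by simp
    then show False using v dirs_scale_imp_K[OF x z(2)] bsg_scale by metis
  qed
  have "b \<noteq> 0"
  proof
    assume "b = 0"
    then have "v = a *s z" using ab by simp
    then show False using v dirs_scale_imp_K[OF x z(1)] bsg_scale by metis
  qed
  have "cross x v = - ((a * c) *s cv z + (b * d) *s cv w)"
    using c d by (simp add: ab rel_def cross_linear vector_smult_assoc)
  moreover have "cross x v = - ((e * a) *s cv z + (e * b) *s cv w)"
    using e(2) by (simp add: ab rel_def K vec.scale_right_distrib vector_smult_assoc)
  ultimately have "(a * c - e * a) *s cv z + (b * d - e * b) *s cv w = 0"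
    by (simp add: vec3_simps algebra_simps)
  then have "cj (a * c - e * a) *s z + cj (b * d - e * b) *s w = 0"
    by (rule cv_combination_eq_0)
  then have "a * c - e * a = 0 \<and> b * d - e * b = 0" using ind cj_eq_0_iff by blast
  then show ?thesis using \<open>a \<noteq> 0\<close> \<open>b \<noteq> 0\<close> by (simp add: mult.commute)
qed

lemma dirs_nonempty: "h x x = - 1 \<Longrightarrow> dirs x \<noteq> {}"
  using card_image_dirs[of x] by auto

lemma family_nonempty: "\<Omega> \<noteq> {}"
proof -
  obtain x where "h x x = - 1" by (rule affine_vector_exists)
  then show ?thesis using dirs_nonempty by (auto simp: dirs_def)
qed

text \<open>A two-dimensional $\mathrm{GF}(q)$-space contains only $q+1$ points, so by counting
  all directions with the right constant occur.\<close>

lemma dirs_eq_rel: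
  assumes x: "h x x = - 1"
  obtains c where "c * cj c = 1" "\<And>z. z \<noteq> 0 \<Longrightarrow> bsg x z \<in> \<Omega> \<longleftrightarrow> rel c x z"
proof -
  obtain z where z: "z \<in> dirs x" using dirs_nonempty[OF x] by blast
  obtain c where c: "c * cj c = 1" "rel c x z" using dirs_rel[OF x z] .
  have c0: "c \<noteq> 0" using c(1) by auto
  have rel: "rel c x w" if "w \<in> dirs x" for w
    using dirs_rel[OF x that] dirs_rel_eq[OF x z that c(2)] by metis
  have "card {bsg x z} < card (bsg x ` dirs x)"
    unfolding card_image_dirs[OF x] using q_gt_1 by simp
  then have "\<not> bsg x ` dirs x \<subseteq> {bsg x z}" by (meson card_mono finite leD)
  then obtain w where w: "w \<in> dirs x" "bsg x w \<noteq> bsg x z" by auto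
  have par: "w \<noteq> k *s z" for k
    using dirs_scale_imp_K[OF x z, of k] bsg_scale[of k x z] w by auto
  have z0: "z \<noteq> 0" using z by (simp add: dirs_def)
  \<comment> \<open>\<open>G\<close> lists the points of the projective line over GF(q) spanned by
    \<open>z\<close> and \<open>w\<close>.\<close>
  define G where "G = insert (bsg x z) ((\<lambda>t. bsg x (t *s z + w)) ` K)"
  have "card G \<le> Suc (card ((\<lambda>t. bsg x (t *s z + w)) ` K))"
    unfolding G_def by (rule card_insert_le_m1) auto
  also have "\<dots> \<le> Suc (card K)" using card_image_le[of K] by simp
  also have "\<dots> \<le> q + 1" using card_K_le by simp
  finally have card_G: "card G \<le> q + 1" .
  have G: "bsg x v \<in> G" if v: "v \<noteq> 0" "rel c x v" for v
  proof -
    have "h v x = 0" using rel_orthogonal[OF v(2) c0] h_eq_0_sym by blast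
    then obtain a b where ab: "v = a *s z + b *s w" using dirs_coordinates[OF x z w(1) par] by blast
    have "cross x v = - ((a * c) *s cv z + (b * c) *s cv w)"
      using rel[OF z] rel[OF w(1)] by (simp add: ab rel_def cross_linear vector_smult_assoc)
    moreover have "cross x v = - ((c * cj a) *s cv z + (c * cj b) *s cv w)"
      using v(2) by (simp add: ab rel_def vec.scale_right_distrib vector_smult_assoc)
    ultimately have "(a * c - c * cj a) *s cv z + (b * c - c * cj b) *s cv w = 0"
      by (simp add: vec3_simps algebra_simps)
    then have "cj (a * c - c * cj a) *s z + cj (b * c - c * cj b) *s w = 0"
    by (rule cv_combination_eq_0)
    then have "a * c - c * cj a = 0 \<and> b * c - c * cj b = 0"
      using not_parallel_imp_independent[OF z0 par] cj_eq_0_iff by blast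
    then have K: "a \<in> K" "b \<in> K" using c0 by (simp_all add: K_def mult.commute)
    show ?thesis
    proof (cases "b = 0")
      case True
      then have "a \<noteq> 0" using v(1) ab by auto
      then show ?thesis using True K(1) by (simp add: ab bsg_scale G_def)
    next
      case False
      then have "v = b *s ((a / b) *s z + w)" by (simp add: ab vec.scale_right_distrib vector_smult_assoc)
      then have "bsg x v = bsg x ((a / b) *s z + w)" using K(2) False bsg_scale by metis
      then show ?thesis using K_closed(7)[OF K] by (simp add: G_def)
    qed
  qed
  have sub: "bsg x ` dirs x \<subseteq> G" using G rel by (auto simp: dirs_def)
  have "bsg x ` dirs x = G"
    using sub card_G card_image_dirs[OF x] by (intro card_seteq) auto
  then have "bsg x v \<in> \<Omega>" if "v \<noteq> 0" "rel c x v" for v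
    using G[OF that] by (auto simp: dirs_def)
  then show thesis using that[OF c(1)] rel by (auto simp: dirs_def)
qed

lemma family_eq_rel:
  obtains c where "c * cj c = 1" "\<And>x z. h x x = - 1 \<Longrightarrow> z \<noteq> 0 \<Longrightarrow> bsg x z \<in> \<Omega> \<longleftrightarrow> rel c x z"
proof -
  have "\<forall>x. \<exists>c. h x x = - 1 \<longrightarrow> c * cj c = 1 \<and> (\<forall>z. z \<noteq> 0 \<longrightarrow> (bsg x z \<in> \<Omega> \<longleftrightarrow> rel c x z))"
    using dirs_eq_rel by metis
  then obtain C where C: "\<And>x. h x x = - 1 \<Longrightarrow> C x * cj (C x) = 1"
    "\<And>x z. h x x = - 1 \<Longrightarrow> z \<noteq> 0 \<Longrightarrow> bsg x z \<in> \<Omega> \<longleftrightarrow> rel (C x) x z"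
    by metis
  \<comment> \<open>The same element of \<open>\<Omega>\<close> is viewed from another of its affine
    points.\<close>
  have step: "C (x + k *s z) = C x" if "h x x = - 1" "z \<noteq> 0" "rel (C x) x z" "k \<in> K" for x z k
  proof -
    have "bsg x z \<in> \<Omega>" using C(2) that by blast
    then have om: "bsg (x + k *s z) z \<in> \<Omega>" using bsg_translate[OF that(4)] by simp
    then have "h (x + k *s z) (x + k *s z) = - 1" using bsg_isotropic subgenerator by blast
    then have "rel (C (x + k *s z)) (x + k *s z) z" using C(2) om that(2) by blast
    then show ?thesis using rel_unique rel_translate that(2,3) by metis
  qed
  have coll: "C (x + u) = C x" if "h x x = - 1" "h x u = 0" "h u u = 0" for x u
    using constant_on_generators[of C, OF C(1) step that] by blast
  have iso: "\<exists>z. z \<noteq> 0 \<and> h z z = 0 \<and> h x z = 0" if "h x x = - 1" for x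
    using dirs_nonempty[OF that] bsg_isotropic subgenerator by (fastforce simp: dirs_def)
  have const: "C y = C x" if "h x x = - 1" "h y y = - 1" for x y
    using constant_on_affine_points[of C, OF coll iso that] by blast
  obtain x0 where x0: "h x0 x0 = - 1" by (rule affine_vector_exists)
  show thesis
    using that[of "C x0"] C const[OF x0] x0 by metis
qed

end

section \<open>The action of the special unitary group\<close>

context gfq2
begin

section \<open>Determinants and isometries\<close>

definition columns :: "'a ^ 3 \<Rightarrow> 'a ^ 3 \<Rightarrow> 'a ^ 3 \<Rightarrow> 'a ^ 3 ^ 3" where
  "columns x y z = (\<chi> i j. if j = 1 then x $ i else if j = 2 then y $ i else z $ i)"

lemma columns_mult_vec: "columns x y z *v a = a $ 1 *s x + a $ 2 *s y + a $ 3 *s z"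
  by (simp add: columns_def matrix_vector_mult_def sum_3 vec3_simps mult.commute)

lemma mult_columns: "A ** columns x y z = columns (A *v x) (A *v y) (A *v z)"
  by (simp add: columns_def matrix_matrix_mult_def matrix_vector_mult_def vec_eq_iff)

lemma det_columns: "det (columns x y z) = h (cross x y) (cv z)"
  by (simp add: det_3 columns_def h_expand algebra_simps)

text \<open>Pairing with the conjugate of \<open>A *v w\<close> turns the vector product into a
  determinant, which \<open>A\<close> preserves, and the other side into a value of
  \<open>h\<close>, which \<open>A\<close> also preserves.\<close>

lemma rel_SU3:
  assumes A: "A \<in> SU3_matrices q" and "rel c x z"
  shows "rel c (A *v x) (A *v z)"
proof -
  have detA: "det A = 1" and iso: "h (A *v X) (A *v Y) = h X Y" for X Y
    using A by (simp_all add: SU3_matrices_def)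
  have "invertible A" using detA by (simp add: invertible_det_nz)
  then obtain B where B: "A ** B = mat 1" unfolding invertible_def by blast
  have "h (cross (A *v x) (A *v z) + c *s cv (A *v z)) v = 0" for v
  proof -
    define w where "w = B *v cv v"
    have w: "cv v = A *v w" by (simp add: w_def matrix_vector_mul_assoc B)
    then have v: "v = cv (A *v w)" by (metis cv_simps(4))
    have "h (cross (A *v x) (A *v z)) (cv (A *v w)) = det A * det (columns x z w)"
      by (simp add: det_columns[symmetric] mult_columns[symmetric] det_mul)
    also have "\<dots> = h (- (c *s cv z)) (cv w)"
      using assms(2) by (simp add: detA det_columns rel_def)
    also have "\<dots> = h (- (c *s cv (A *v z))) (cv (A *v w))" by (simp add: iso)
    finally show ?thesis unfolding v by simp
  qed
  then have "cross (A *v x) (A *v z) + c *s cv (A *v z) = 0" by (rule h_nondegenerate)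
  then show ?thesis by (simp add: rel_def eq_neg_iff_add_eq_0)
qed

text \<open>A vector paired with \<open>z\<close> to 1 is projected orthogonally to
  \<open>x\<close>, then made isotropic by adding a multiple of \<open>z\<close> with suitable
  trace.\<close>

lemma rel_completion:
  assumes x: "h x x = - 1" and z: "z \<noteq> 0" "rel c x z" "c \<noteq> 0"
  obtains f where "h f x = 0" "h f f = 0" "h z f = 1"
proof -
  note o = rel_orthogonal[OF z(2,3)]
  have zx: "h z x = 0" using o(1) h_eq_0_sym by blast
  obtain w' where w': "h z w' \<noteq> 0" using h_nondegenerate z(1) by blast
  define w where "w = cj (1 / h z w') *s w'"
  have w: "h z w = 1" using w' by (simp add: w_def del: cj_divide)
  define g where "g = w + h w x *s x"
  have gx: "h g x = 0" using x by (simp add: g_def)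
  have zg: "h z g = 1" using w zx by (simp add: g_def)
  have gz: "h g z = 1" using zg h_cj[of z g] by simp
  have "- h g g \<in> K" by (intro K_closed h_self_K)
  then obtain t where t: "t + cj t = - h g g" by (rule trace_surj)
  define f where "f = g + t *s z"
  have "h f x = 0" "h z f = 1" using gx zx zg o by (simp_all add: f_def)
  moreover have "h f f = h g g + (t + cj t)" using zg gz o by (simp add: f_def)
  then have "h f f = 0" using t by simp
  ultimately show thesis using that by blast
qed

text \<open>The completed bases have equal Gram matrices, so the map between them is an isometry;
  both have determinant \<open>- c\<close>, so its determinant is 1.\<close>

lemma SU3_transitive:
  assumes x: "h x x = - 1" "z \<noteq> 0" "rel c x z" and y: "h y y = - 1" "w \<noteq> 0" "rel c y w"
    and c: "c \<noteq> 0"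
  obtains A where "A \<in> SU3_matrices q" "A *v x = y" "A *v z = w"
proof -
  obtain f where f: "h f x = 0" "h f f = 0" "h z f = 1" using rel_completion[OF x c] .
  obtain g where g: "h g y = 0" "h g g = 0" "h w g = 1" using rel_completion[OF y c] .
  define M where "M = columns x z f"
  define N where "N = columns y w g"
  have detM: "det M = - c"
    using x(3) f(3) h_cj[of z f] by (simp add: M_def det_columns rel_def)
  have detN: "det N = - c"
    using y(3) g(3) h_cj[of w g] by (simp add: N_def det_columns rel_def)
  have "invertible M" using detM c by (simp add: invertible_det_nz)
  then obtain B where B: "M ** B = mat 1" "B ** M = mat 1" unfolding invertible_def by blast
  define A where "A = N ** B"
  have AM: "A ** M = N" by (simp add: A_def B matrix_mul_assoc[symmetric] matrix_mul_rid)
  have "det A * det M = det N" by (simp add: AM[symmetric] det_mul)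
  then have "det A = 1" using detM detN c by simp
  moreover have "h (A *v X) (A *v Y) = h X Y" for X Y
  proof -
    have MN: "h (M *v a) (M *v b) = h (N *v a) (N *v b)" for a b
      using x(1) f y(1) g rel_orthogonal[OF x(3) c] rel_orthogonal[OF y(3) c]
        h_cj[of x z] h_cj[of y w] h_cj[of z f] h_cj[of w g] h_cj[of f x] h_cj[of g y]
      by (simp add: M_def N_def columns_mult_vec)
    have "A *v X = N *v (B *v X)" "M *v (B *v X) = X" for X
      by (simp_all add: A_def B matrix_vector_mul_assoc)
    then show ?thesis using MN by metis
  qed
  ultimately have "A \<in> SU3_matrices q" by (simp add: SU3_matrices_def)
  moreover have cols: "columns (A *v x) (A *v z) (A *v f) = columns y w g"
    using AM by (simp add: M_def N_def mult_columns)
  have "A *v x = y"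
    using arg_cong[OF cols, of "\<lambda>m. m *v axis 1 1"] by (simp add: columns_mult_vec axis_def)
  moreover have "A *v z = w"
    using arg_cong[OF cols, of "\<lambda>m. m *v axis 2 1"] by (simp add: columns_mult_vec axis_def)
  ultimately show thesis using that by blast
qed

section \<open>The action on Baer subgenerators\<close>

lemma block_matrix_emb: "block_matrix A *v emb x s = emb (A *v x) s"
  by (simp add: vec_eq_iff forall_4 matrix_vector_mult_def block_matrix_def sum_4 sum_3
      index_3_def index_0_eq_3)

lemma collineation_span: "collineation M (vec.span {X}) = vec.span {M *v X}"
  by (auto simp: collineation_def vec.span_singleton image_image vector_scalar_commute)

lemma collineation_bsg:
  "collineation (block_matrix A) ` bsg x z = bsg (A *v x) (A *v z)"
  by (simp add: bsg_def image_image collineation_span block_matrix_emb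
      matrix_vector_right_distrib vector_scalar_commute)

end

theorem theorem2p6:
  fixes q :: nat
    and \<Omega> :: "('a::{field,finite} ^ 4) set set set"
  assumes "primepow q"
    and "CARD('a) = q ^ 2"
    and "\<forall>b\<in>\<Omega>. baer_subgenerator q b"
    and "\<forall>b\<in>\<Omega>. b \<inter> hermitian_curve q \<noteq> {}"
    and "\<forall>P\<in>affine_points q.
           card {b\<in>\<Omega>. P \<in> b} = q + 1 \<and> spans_baer_subplane q {b\<in>\<Omega>. P \<in> b}"
  shows "\<Omega> \<in> orbits (SU3_group q) {b. baer_subgenerator q b} (\<lambda>g b. g ` b)"
proof -
  interpret baer_subgenerator_family q "TYPE('a)" \<Omega>
    by unfold_locales (use assms in auto)
  obtain c where c: "c * cj c = 1"
    and rel: "\<And>x z. h x x = - 1 \<Longrightarrow> z \<noteq> 0 \<Longrightarrow> bsg x z \<in> \<Omega> \<longleftrightarrow> rel c x z"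
    using family_eq_rel by blast
  have c0: "c \<noteq> 0" using c by auto
  have member: "\<exists>x z. h x x = - 1 \<and> z \<noteq> 0 \<and> rel c x z \<and> b = bsg x z" if b: "b \<in> \<Omega>" for b
  proof -
    obtain x where x: "h x x = - 1" "vec.span {emb x 1} \<in> b"
      using baer_subgenerator_affine_point[OF subgenerator[OF b]] .
    obtain z where "z \<noteq> 0" "b = bsg x z" using member_eq_bsg[OF b x(2)] .
    then show ?thesis using rel[OF x(1)] x(1) b by blast
  qed
  obtain b0 where b0: "b0 \<in> \<Omega>" using family_nonempty by blast
  obtain x z where xz: "h x x = - 1" "z \<noteq> 0" "rel c x z" "b0 = bsg x z" using member[OF b0] by blast
  have "orbit (SU3_group q) (\<lambda>g b. g ` b) b0
      = {collineation (block_matrix A) ` b0 | A. A \<in> SU3_matrices q}"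
    by (simp add: orbit_def SU3_group_def) blast
  also have "\<dots> = {bsg (A *v x) (A *v z) | A. A \<in> SU3_matrices q}"
    by (simp only: xz(4) collineation_bsg)
  also have "\<dots> = \<Omega>"
  proof (intro subset_antisym subsetI)
    fix b assume "b \<in> {bsg (A *v x) (A *v z) | A. A \<in> SU3_matrices q}"
    then obtain A where A: "A \<in> SU3_matrices q" "b = bsg (A *v x) (A *v z)" by blast
    have iso: "h (A *v X) (A *v Y) = h X Y" for X Y using A(1) by (simp add: SU3_matrices_def)
    have "A *v z \<noteq> 0"
    proof
      assume "A *v z = 0"
      then have "h z Y = 0" for Y using iso[of z Y] by simp
      then show False using h_nondegenerate xz(2) by blast
    qed
    then show "b \<in> \<Omega>" using rel rel_SU3[OF A(1) xz(3)] xz(1) by (simp add: A(2) iso)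
  next
    fix b assume "b \<in> \<Omega>"
    then obtain y w where yw: "h y y = - 1" "w \<noteq> 0" "rel c y w" "b = bsg y w" using member by blast
    obtain A where "A \<in> SU3_matrices q" "A *v x = y" "A *v z = w"
      using SU3_transitive[OF xz(1-3) yw(1-3) c0] .
    then show "b \<in> {bsg (A *v x) (A *v z) | A. A \<in> SU3_matrices q}" using yw(4) by blast
  qed
  finally have "orbit (SU3_group q) (\<lambda>g b. g ` b) b0 = \<Omega>" .
  then show ?thesis using subgenerator[OF b0] by (auto simp: orbits_def)
qed

end
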